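(* Assume $\mathfrak b=\mathfrak c$. Then for every $n\geq 2$ there exists a Hausdorff topological space which is $n$-sequentially compact but not $(n+1)$-sequentially compact.
   Context: $[B]^n$ denotes the set of all subsets of $B$ of cardinality $n$ and $[B]^\omega$ the set of all countably infinite subsets of $B$. For a topological space $X$, a countable set $B$, $n\ge 1$, a function $f:[B]^n\to X$ and $p\in X$, $f$ converges to $p$ if for every neighborhood $U$ of $p$ there is a finite $F\subseteq B$ with $f''[B\setminus F]^n\subseteq U$ (where $f''S=\{f(x):x\in S\}$); $f$ is convergent if it converges to some $p\in X$. The space $X$ is $n$-sequentially compact if for every $f:[\omega]^n\to X$ there is $B\in[\omega]^\omega$ such that $f\restriction[B]^n$ is convergent. For $f,g\in\omega^\omega$, $f\le^* g$ means that $\{k:f(k)>g(k)\}$ is finite. $\mathfrak b$ is the minimum size of a family $\mathcal B\subseteq\omega^\omega$ that is unbounded, i.e. for every $f\in\omega^\omega$ there is $b\in\mathcal B$ with $b\not\le^* f$. $\mathfrak c=|\mathbb R|$. *)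

theory Defs
  imports "HOL-Analysis.Analysis" "HOL-Library.Ramsey"
begin

unbundle cardinal_syntax

definition le_star :: "(nat \<Rightarrow> nat) \<Rightarrow> (nat \<Rightarrow> nat) \<Rightarrow> bool"  (infix \<open>\<le>*\<close> 50)
  where "f \<le>* g \<longleftrightarrow> finite {k. f k > g k}"

definition unbounded_family :: "(nat \<Rightarrow> nat) set \<Rightarrow> bool"
  where "unbounded_family \<B> \<longleftrightarrow> (\<forall>f. \<exists>b\<in>\<B>. \<not> b \<le>* f)"

(* A cardinal is a well-order up to =o, so the minimum size is the cardinal of some
   unbounded family of least size; one exists by bounding_number_minimum below. *)
definition bounding_number :: "(nat \<Rightarrow> nat) rel"
  where "bounding_number =
    |SOME \<B>. unbounded_family \<B> \<and> (\<forall>\<C>. unbounded_family \<C> \<longrightarrow> |\<B>| \<le>o |\<C>| )|"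

lemma unbounded_family_UNIV: "unbounded_family UNIV"
  unfolding unbounded_family_def
proof
  fix f :: "nat \<Rightarrow> nat"
  have "\<not> (\<lambda>k. Suc (f k)) \<le>* f"
    by (simp add: le_star_def)
  then show "\<exists>b\<in>UNIV. \<not> b \<le>* f"
    by blast
qed

lemma bounding_number_minimum:
  "\<exists>\<B>. unbounded_family \<B> \<and> bounding_number = |\<B>| \<and>
    (\<forall>\<C>. unbounded_family \<C> \<longrightarrow> |\<B>| \<le>o |\<C>| )"
proof -
  let ?R = "card_of ` Collect unbounded_family"
  have "\<exists>r\<in>?R. \<forall>r'\<in>?R. r \<le>o r'"
    using unbounded_family_UNIV by (intro exists_minim_Card_order) (auto simp: card_of_Card_order)
  then have "\<exists>\<B>. unbounded_family \<B> \<and> (\<forall>\<C>. unbounded_family \<C> \<longrightarrow> |\<B>| \<le>o |\<C>| )"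
    by auto
  from someI_ex[OF this] show ?thesis
    unfolding bounding_number_def by blast
qed

(* f is only relevant on [B]^n. *)
definition nset_converges_to ::
  "'a topology \<Rightarrow> nat \<Rightarrow> 'b set \<Rightarrow> ('b set \<Rightarrow> 'a) \<Rightarrow> 'a \<Rightarrow> bool"
  where "nset_converges_to X n B f p \<longleftrightarrow>
    p \<in> topspace X \<and>
    (\<forall>U. openin X U \<and> p \<in> U \<longrightarrow> (\<exists>F. finite F \<and> F \<subseteq> B \<and> f ` nsets (B - F) n \<subseteq> U))"

definition nset_convergent :: "'a topology \<Rightarrow> nat \<Rightarrow> 'b set \<Rightarrow> ('b set \<Rightarrow> 'a) \<Rightarrow> bool"
  where "nset_convergent X n B f \<longleftrightarrow> (\<exists>p. nset_converges_to X n B f p)"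

definition n_sequentially_compact :: "nat \<Rightarrow> 'a topology \<Rightarrow> bool"
  where "n_sequentially_compact n X \<longleftrightarrow>
    (\<forall>f \<in> nsets (UNIV :: nat set) n \<rightarrow> topspace X.
       \<exists>B. infinite B \<and> nset_convergent X n B f)"

(* HOL cannot quantify existentially over types, so the existence of a space is stated for
   topologies whose points are of the fixed type nat set, with arbitrary carrier topspace X.
   This loses no generality: let Y, on any type, be Hausdorff, n-sequentially compact and not
   (n+1)-sequentially compact, the latter witnessed by g.  There are only continuum many
   functions from [omega]^n into a set of size at most continuum, so closing the range of g
   under one chosen limit (along some infinite B) for each such function, omega_1 times,
   gives a subspace of Y of size at most continuum that still has the three properties:
   every countable subset of it appears at a countable stage, and a limit of g on some
   infinite B in the subspace would be one in Y. *)

end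

(* Let S be the set of all (n+1)-subsets of the naturals and take the one-point compactification
   of the Mrowka-Isbell space of an almost disjoint family (A_j) of subsets of S, where j ranges over
   the infinite sets of naturals. With fewer than b members such a space is sequentially compact
   and all its characters are below b, hence it is n-sequentially compact for every n. Build the
   family in continuum (= b) many steps; at step j restrict the j-th function from n-subsets
   into S to a set on which it converges in the space built so far, and protect its range:
   every later A_i shall meet it in a finite set only. A function of n variables takes values
   among (n+1)-subsets, so by a canonical Ramsey argument and the pigeonhole principle it can
   be restricted so that its range is "thin": at some position k, an entry of a value is determined,
   up to finitely many choices, by the preceding entries. Fewer than b thin sets can be evaded
   by an infinite A_j consisting of (n+1)-subsets of j, so the identity on S converges on no j. *)
theory Submission
  imports Defs
begin

subsection \<open>Ramsey and domination\<close>

text \<open>In the finished space the subbase at infinity no longer has fewer than b members, so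
  convergence has to be obtained at a stage and then carried through all later stages; this is why
  ranges are protected. An infinite set j has two roles: it codes a function to be treated, and it
  is a domain on which the identity must be spoiled. Two demands on \<open>A j\<close> pull against
  each other: it must be large enough to keep the identity on j from converging to infinity, yet so
  small that the identity does not converge to the point j. Blocks of n+1 consecutive elements of
  some D inside j meet both: they occur in every tail of D, but each number lies in only finitely
  many. The pigeonhole compares n+1 entries of a value with n coordinates of the argument: reading
  the entries in order, some entry brings in no new coordinate, so the preceding ones determine it.
  Evasion works because the gaps of D outgrow a function that dominates the bounds on these entries;
  this is a second use of b, beside the one for characters.\<close>

lemma Ramsey_finite_colours:
  fixes f :: "'a set \<Rightarrow> 'b"
  assumes "infinite Z" "finite K" "f ` nsets Z r \<subseteq> K"
  obtains Y t where "Y \<subseteq> Z" "infinite Y" "\<And>x. x \<in> nsets Y r \<Longrightarrow> f x = t"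
proof -
  obtain h where h: "bij_betw h K {0..<card K}"
    using ex_bij_betw_finite_nat[OF assms(2)] by blast
  have "(h \<circ> f) ` nsets Z r \<subseteq> {..<card K}"
    using assms(3) bij_betwE[OF h] by fastforce
  with assms(1) obtain Y t where Y: "Y \<subseteq> Z" "infinite Y" "(h \<circ> f) ` nsets Y r \<subseteq> {t}"
    by (rule Ramsey_nsets)
  obtain x0 where x0: "x0 \<in> nsets Y r"
    using infinite_imp_infinite_nsets[of Y r] nsets_eq_empty_iff[of Y r] Y(2) by blast
  have mem: "f x \<in> K" if "x \<in> nsets Y r" for x
    using assms(3) nsets_mono[OF Y(1)] that by blast
  have "f x = f x0" if "x \<in> nsets Y r" for x
  proof -
    have "h (f x) = h (f x0)"
      using Y(3) that x0 by auto
    then show ?thesis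
      using mem that x0 bij_betw_imp_inj_on[OF h] by (auto dest: inj_onD)
  qed
  with Y show thesis
    using that by blast
qed

text \<open>Some unbounded family of least size has cardinality b, so the smaller family of all
  \<open>h i\<close> cannot be unbounded. The indices will be neighbourhoods or thin sets.\<close>

lemma dominating_function:
  fixes h :: "'i \<Rightarrow> nat \<Rightarrow> nat"
  assumes "|I| <o bounding_number"
  obtains f where "\<And>i. i \<in> I \<Longrightarrow> \<exists>N. \<forall>m\<ge>N. h i m \<le> f m"
proof -
  obtain \<B> where \<B>: "bounding_number = |\<B>|"
    "\<forall>\<C>. unbounded_family \<C> \<longrightarrow> |\<B>| \<le>o |\<C>|"
    using bounding_number_minimum by blast
  have "|h ` I| <o |\<B>|"
    using assms card_of_image ordLeq_ordLess_trans unfolding \<B>(1) by blast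
  then have "\<not> unbounded_family (h ` I)"
    using \<B>(2) not_ordLess_ordLeq by blast
  then obtain f where f: "\<And>i. i \<in> I \<Longrightarrow> h i \<le>* f"
    unfolding unbounded_family_def by blast
  have "\<exists>N. \<forall>m\<ge>N. h i m \<le> f m" if "i \<in> I" for i
  proof -
    have "finite {m. f m < h i m}"
      using f[OF that] unfolding le_star_def by simp
    then obtain N where "{m. f m < h i m} \<subseteq> {..<N}"
      using finite_nat_iff_bounded by blast
    then show ?thesis
      by (metis lessThan_iff linorder_not_less mem_Collect_eq subsetD)
  qed
  then show thesis
    using that by blast
qed

text \<open>Diagonalization: the maximum at \<open>k\<close> of the first \<open>k + 1\<close>
  members of a countable family eventually dominates each of them.\<close>

lemma countable_ordLess_bounding_number:
  assumes "countable A"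
  shows "|A| <o bounding_number"
proof -
  obtain \<B> where \<B>: "unbounded_family \<B>" "bounding_number = |\<B>|"
    using bounding_number_minimum by blast
  have "\<not> countable \<B>"
  proof
    assume c: "countable \<B>"
    define f where "f k = Max ((\<lambda>i. from_nat_into \<B> i k) ` {..k})" for k
    obtain b where b: "b \<in> \<B>" "\<not> b \<le>* f"
      using \<B>(1) unfolding unbounded_family_def by blast
    obtain i where i: "b = from_nat_into \<B> i"
      using from_nat_into_surj[OF c b(1)] by metis
    have "b k \<le> f k" if "i \<le> k" for k
      unfolding f_def i using that by (intro Max_ge) auto
    then have "{k. f k < b k} \<subseteq> {..<i}"
      by (metis (mono_tags, lifting) lessThan_iff mem_Collect_eq not_le subsetI)
    then show False
      using b(2) finite_subset unfolding le_star_def by blast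
  qed
  have "\<not> |\<B>| \<le>o |A|"
  proof
    assume "|\<B>| \<le>o |A|"
    then obtain f where f: "inj_on f \<B>" "f ` \<B> \<subseteq> A"
      unfolding card_of_ordLeq[symmetric] by blast
    then have "countable (f ` \<B>)"
      using assms countable_subset by blast
    then show False
      using f(1) \<open>\<not> countable \<B>\<close> countable_image_inj_on by blast
  qed
  then show ?thesis
    unfolding \<B>(2) not_ordLeq_iff_ordLess[OF card_of_Well_order card_of_Well_order] .
qed

lemma Un_ordLess_bounding_number:
  assumes "|A| <o bounding_number" "|B| <o bounding_number"
  shows "|A \<union> B| <o bounding_number"
proof -
  obtain \<B> where \<B>: "bounding_number = |\<B>|"
    using bounding_number_minimum by blast
  have "infinite \<B>"
  proof
    assume "finite \<B>"
    then have "|\<B>| <o |\<B>|"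
      using countable_ordLess_bounding_number[of \<B>] countable_finite unfolding \<B> by blast
    then show False
      using ordLess_irreflexive by blast
  qed
  then show ?thesis
    using assms card_of_Un_ordLess_infinite unfolding \<B> by blast
qed

lemma image_ordLess_bounding_number:
  "|A| <o bounding_number \<Longrightarrow> |f ` A| <o bounding_number"
  using card_of_image ordLeq_ordLess_trans by blast

text \<open>Greedy choice: each new element exceeds \<open>h\<close> of its predecessor, and later
  elements are larger still, which covers all pairs \<open>x < y\<close>.\<close>

lemma sparse_subset:
  fixes h :: "nat \<Rightarrow> nat"
  assumes "infinite B"
  obtains B' where "B' \<subseteq> B" "infinite B'" "\<And>x y. x \<in> B' \<Longrightarrow> y \<in> B' \<Longrightarrow> x < y \<Longrightarrow> h x < y"
proof -
  have "\<exists>y. y \<in> B \<and> x < y \<and> h x < y" for x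
  proof -
    obtain y where "y \<in> B" "max x (h x) < y"
      using assms infinite_nat_iff_unbounded by blast
    then show ?thesis
      by (auto intro!: exI[of _ y])
  qed
  then obtain next_of where next_of: "\<And>x. next_of x \<in> B \<and> x < next_of x \<and> h x < next_of x"
    by metis
  define f where "f k = (next_of ^^ Suc k) 0" for k
  have f: "f (Suc k) = next_of (f k)" "f k \<in> B" for k
    using next_of by (simp_all add: f_def)
  then have mono: "strict_mono f"
    using next_of by (simp add: strict_mono_Suc_iff)
  show thesis
  proof (rule that[of "range f"])
    show "range f \<subseteq> B"
      using f(2) by blast
    show "infinite (range f)"
      using mono by (metis finite_imageD infinite_UNIV_nat strict_mono_imp_inj_on)
    show "h x < y" if "x \<in> range f" "y \<in> range f" "x < y" for x y
    proof -
      from that obtain m n where mn: "x = f m" "y = f n"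
        by blast
      then have "Suc m \<le> n"
        using that(3) mono by (simp add: strict_mono_less Suc_leI)
      then have "f (Suc m) \<le> f n"
        using mono by (simp add: strict_mono_less_eq)
      then show ?thesis
        using next_of[of "f m"] f(1)[of m] unfolding mn by simp
    qed
  qed
qed

subsection \<open>Canonical position patterns and thin sets\<close>

text \<open>The rank, counted from 0; for \<open>x\<close> outside \<open>u\<close> it is the rank
  that \<open>x\<close> would get if it were inserted.\<close>

definition pos :: "nat set \<Rightarrow> nat \<Rightarrow> nat"
  where "pos u x = card (u \<inter> {..<x})"

definition sel :: "nat set \<Rightarrow> nat set \<Rightarrow> nat set"
  where "sel u p = {x \<in> u. pos u x \<in> p}"

lemma pos_mono: "x \<le> y \<Longrightarrow> pos u x \<le> pos u y"
  unfolding pos_def by (intro card_mono) auto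

lemma pos_less:
  assumes "x \<in> u" "x < y"
  shows "pos u x < pos u y"
  unfolding pos_def using assms by (intro psubset_card_mono) auto

lemma pos_less_iff: "x \<in> u \<Longrightarrow> y \<in> u \<Longrightarrow> pos u x < pos u y \<longleftrightarrow> x < y"
  using pos_less[of x u y] pos_mono[of y x u] by (cases "x < y") auto

lemma inj_on_pos: "inj_on (pos u) u"
proof (rule inj_onI)
  fix x y
  assume "x \<in> u" "y \<in> u" "pos u x = pos u y"
  then show "x = y"
    using pos_less[of x u y] pos_less[of y u x] by (cases x y rule: linorder_cases) auto
qed

lemma pos_lt_card:
  assumes "finite u" "x \<in> u"
  shows "pos u x < card u"
  unfolding pos_def using assms by (intro psubset_card_mono) auto

lemma pos_image:
  assumes "finite u"
  shows "pos u ` u = {..<card u}"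
proof (rule card_subset_eq)
  show "pos u ` u \<subseteq> {..<card u}"
    using pos_lt_card[OF assms] by auto
  show "card (pos u ` u) = card {..<card u}"
    by (simp add: card_image inj_on_pos)
qed auto

lemma sel_pos_image: "s \<subseteq> u \<Longrightarrow> sel u (pos u ` s) = s"
  unfolding sel_def using inj_on_pos[of u] by (auto dest: inj_onD)

lemma pos_strict_mono_image:
  assumes "strict_mono_on u \<sigma>" "x \<in> u"
  shows "pos (\<sigma> ` u) (\<sigma> x) = pos u x"
proof -
  have "\<sigma> ` u \<inter> {..<\<sigma> x} = \<sigma> ` (u \<inter> {..<x})"
    using assms by (auto simp: strict_mono_on_less)
  moreover have "inj_on \<sigma> (u \<inter> {..<x})"
    using assms(1) by (meson Int_lower1 inj_on_subset strict_mono_on_imp_inj_on)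
  ultimately show ?thesis
    unfolding pos_def by (simp add: card_image)
qed

text \<open>The part of Erdos-Rado canonicity that is used: for two \<open>n\<close>-subsets of
  \<open>B\<close> with at most \<open>N\<close> elements together, equality of the values depends
  only on their relative position.\<close>

definition position_invariant :: "nat set \<Rightarrow> nat \<Rightarrow> nat \<Rightarrow> (nat set \<Rightarrow> 'b) \<Rightarrow> bool"
  where "position_invariant B n N \<phi> \<longleftrightarrow> (\<forall>m\<le>N. \<forall>u\<in>nsets B m. \<forall>v\<in>nsets B m. \<forall>p\<in>nsets {..<m} n. \<forall>q\<in>nsets {..<m} n.
    \<phi> (sel u p) = \<phi> (sel u q) \<longrightarrow> \<phi> (sel v p) = \<phi> (sel v q))"

lemma sel_Un:
  assumes "\<And>x y. x \<in> u \<Longrightarrow> y \<in> T \<Longrightarrow> x < y" "finite u" "p \<subseteq> {..<card u}"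
  shows "sel (u \<union> T) p = sel u p"
proof -
  have "pos (u \<union> T) x = pos u x" if "x \<in> u" for x
  proof -
    have "(u \<union> T) \<inter> {..<x} = u \<inter> {..<x}"
      using assms(1) that by (auto dest: less_asym)
    then show ?thesis
      unfolding pos_def by simp
  qed
  moreover have "card u \<le> pos (u \<union> T) x" if "x \<in> T" "x \<notin> u" for x
  proof -
    have "u \<subseteq> (u \<union> T) \<inter> {..<x}"
      using assms(1) that by auto
    then show ?thesis
      unfolding pos_def by (intro card_mono) auto
  qed
  ultimately show ?thesis
    using assms(3) unfolding sel_def by fastforce
qed

text \<open>Colour an \<open>N\<close>-set by the finite table of all coincidences between values on
  its \<open>n\<close>-subsets, for all \<open>k\<close> at once; on a homogeneous set this table is
  constant. Smaller sets are padded to size \<open>N\<close>.\<close>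

lemma position_invariant_subset:
  fixes \<phi> :: "'k \<Rightarrow> nat set \<Rightarrow> 'b"
  assumes "infinite C" "finite K"
  obtains B where "B \<subseteq> C" "infinite B" "\<And>k. k \<in> K \<Longrightarrow> position_invariant B n N (\<phi> k)"
proof -
  define P where "P = nsets {..<N} n"
  define col where "col u = {(k, p, q). k \<in> K \<and> p \<in> P \<and> q \<in> P \<and> \<phi> k (sel u p) = \<phi> k (sel u q)}" for u
  have "finite P"
    unfolding P_def by (simp add: finite_imp_finite_nsets)
  then have "finite (Pow (K \<times> P \<times> P))"
    using assms(2) by simp
  moreover have "col ` nsets C N \<subseteq> Pow (K \<times> P \<times> P)"
    unfolding col_def by auto
  ultimately obtain B t where B: "B \<subseteq> C" "infinite B" "\<And>u. u \<in> nsets B N \<Longrightarrow> col u = t"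
    using Ramsey_finite_colours[OF assms(1)] by metis
  have "position_invariant B n N (\<phi> k)" if k: "k \<in> K" for k
    unfolding position_invariant_def
  proof (intro allI ballI impI)
    fix m u v p q
    assume m: "m \<le> N" and u: "u \<in> nsets B m" and v: "v \<in> nsets B m"
      and p: "p \<in> nsets {..<m} n" and q: "q \<in> nsets {..<m} n"
      and eq: "\<phi> k (sel u p) = \<phi> k (sel u q)"
    have fin: "finite u" "finite v" "card u = m" "card v = m" "u \<subseteq> B" "v \<subseteq> B"
      using u v unfolding nsets_def by auto
    \<comment> \<open>The padding \<open>T\<close> lies above both \<open>u\<close> and
      \<open>v\<close>, so ranks in them do not shift; the 0 covers empty sets.\<close>
    have "infinite (B - {..Max (insert 0 (u \<union> v))})"
      using B(2) by (simp add: Diff_infinite_finite)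
    then obtain T where T: "T \<subseteq> B - {..Max (insert 0 (u \<union> v))}" "finite T" "card T = N - m"
      using infinite_arbitrarily_large by blast
    have less: "x < y" if "x \<in> u \<union> v" "y \<in> T" for x y
    proof -
      have "x \<le> Max (insert 0 (u \<union> v))"
        using fin that(1) by (intro Max_ge) auto
      then show ?thesis
        using T(1) that(2) by fastforce
    qed
    have un: "w \<union> T \<in> nsets B N" if "w = u \<or> w = v" for w
    proof -
      have "w \<inter> T = {}"
        using less that by fastforce
      then show ?thesis
        using that fin T m unfolding nsets_def by (auto simp: card_Un_disjoint)
    qed
    have sel: "sel (w \<union> T) r = sel w r" if "w = u \<or> w = v" "r = p \<or> r = q" for w r
      using less that fin p q by (intro sel_Un) (auto simp: nsets_def)
    have PP: "p \<in> P" "q \<in> P"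
      using p q m nsets_mono[of "{..<m}" "{..<N}" n] unfolding P_def by auto
    have "(k, p, q) \<in> col (u \<union> T)"
      using k PP eq sel unfolding col_def by simp
    then have "(k, p, q) \<in> col (v \<union> T)"
      using B(3) un by metis
    then show "\<phi> k (sel v p) = \<phi> k (sel v q)"
      using sel unfolding col_def by simp
  qed
  then show thesis
    using that B by blast
qed

text \<open>An increasing map preserves ranks in \<open>s \<union> s'\<close>, so the pair and its
  image are selected by the same two patterns.\<close>

lemma position_invariant_image:
  assumes "position_invariant B n N \<phi>" "card (s \<union> s') \<le> N" "s \<in> nsets B n" "s' \<in> nsets B n"
    "strict_mono_on (s \<union> s') \<sigma>" "\<sigma> ` (s \<union> s') \<subseteq> B" "\<phi> s = \<phi> s'"
  shows "\<phi> (\<sigma> ` s) = \<phi> (\<sigma> ` s')"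
proof -
  define u where "u = s \<union> s'"
  have fin: "finite s" "finite s'" "finite u" "u \<subseteq> B" "card s = n" "card s' = n"
    using assms(3,4) unfolding nsets_def u_def by auto
  have inj: "inj_on \<sigma> u"
    using assms(5) strict_mono_on_imp_inj_on unfolding u_def by blast
  have sel: "sel u (pos u ` r) = r" "sel (\<sigma> ` u) (pos u ` r) = \<sigma> ` r" "pos u ` r \<in> nsets {..<card u} n"
    if "r = s \<or> r = s'" for r
  proof -
    have sub: "r \<subseteq> u"
      using that unfolding u_def by auto
    then show "sel u (pos u ` r) = r"
      by (rule sel_pos_image)
    have "pos u ` r = pos (\<sigma> ` u) ` \<sigma> ` r"
      using pos_strict_mono_image[of u \<sigma>] assms(5) sub unfolding u_def[symmetric]
      by (force simp: image_image)
    then show "sel (\<sigma> ` u) (pos u ` r) = \<sigma> ` r"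
      using sel_pos_image[of "\<sigma> ` r" "\<sigma> ` u"] sub by auto
    have "card (pos u ` r) = n"
      using that fin sub inj_on_subset[OF inj_on_pos sub] by (auto simp: card_image)
    then show "pos u ` r \<in> nsets {..<card u} n"
      using that fin sub pos_lt_card[OF fin(3)] unfolding nsets_def by auto
  qed
  have "u \<in> nsets B (card u)" "\<sigma> ` u \<in> nsets B (card u)"
    using fin assms(6) inj unfolding nsets_def u_def[symmetric] by (auto simp: card_image)
  then have "\<phi> (sel (\<sigma> ` u) (pos u ` s)) = \<phi> (sel (\<sigma> ` u) (pos u ` s'))"
    using assms(1,2,7) sel(1,3)[of s] sel(1,3)[of s'] unfolding position_invariant_def u_def[symmetric]
    by metis
  then show ?thesis
    using sel(2) by simp
qed

lemma sel_remove:
  assumes "finite u" "card u = Suc n" "a \<in> u"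
  shows "sel u ({..n} - {pos u a}) = u - {a}"
proof -
  have "pos u x \<le> n" if "x \<in> u" for x
    using pos_lt_card[OF assms(1) that] assms(2) by simp
  moreover have "pos u x = pos u a \<longleftrightarrow> x = a" if "x \<in> u" for x
    using inj_on_pos[of u] that assms(3) by (auto dest: inj_onD)
  ultimately show ?thesis
    unfolding sel_def by auto
qed

text \<open>No element of \<open>w\<close> lies between \<open>a\<close> and \<open>b\<close>, so
  they are consecutive in the enlarged set. This links moving one entry of a set with the deletions
  in \<open>coord_indep\<close>.\<close>

lemma sel_adjacent:
  assumes "finite w" "Suc (card w) = n" "a < b" "\<And>x. x \<in> w \<Longrightarrow> x < a \<or> b < x"
  shows "sel (insert a (insert b w)) ({..n} - {card (w \<inter> {..<a})}) = insert b w"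
    and "sel (insert a (insert b w)) ({..n} - {Suc (card (w \<inter> {..<a}))}) = insert a w"
proof -
  define u where "u = insert a (insert b w)"
  have nin: "a \<notin> w" "b \<notin> w"
    using assms(3,4) by (auto dest: less_asym)
  then have u: "finite u" "card u = Suc n" "a \<in> u" "b \<in> u" "u - {a} = insert b w" "u - {b} = insert a w"
    using assms(1-3) unfolding u_def by auto
  have "u \<inter> {..<a} = w \<inter> {..<a}" "u \<inter> {..<b} = insert a (w \<inter> {..<a})"
    using assms(3,4) unfolding u_def by fastforce+
  then have "pos u a = card (w \<inter> {..<a})" "pos u b = Suc (card (w \<inter> {..<a}))"
    using assms(1) unfolding pos_def by simp_all
  then show "sel (insert a (insert b w)) ({..n} - {card (w \<inter> {..<a})}) = insert b w"
    and "sel (insert a (insert b w)) ({..n} - {Suc (card (w \<inter> {..<a}))}) = insert a w"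
    using sel_remove[OF u(1,2,3)] sel_remove[OF u(1,2,4)] u(5,6) unfolding u_def[symmetric] by simp_all
qed

text \<open>Deleting the \<open>i\<close>-th or the \<open>(i + 1)\<close>-th element of \<open>u\<close> gives two sets that differ in
  coordinate \<open>i\<close> only; for position-invariant functions the choice of \<open>u\<close> is irrelevant.\<close>

definition coord_indep :: "nat set \<Rightarrow> nat \<Rightarrow> (nat set \<Rightarrow> 'b) \<Rightarrow> nat \<Rightarrow> bool"
  where "coord_indep B n \<phi> i \<longleftrightarrow>
    (\<exists>u\<in>nsets B (Suc n). \<phi> (sel u ({..n} - {i})) = \<phi> (sel u ({..n} - {Suc i})))"

lemma coord_indepD:
  assumes "position_invariant B n N \<phi>" "Suc n \<le> N" "i < n" "coord_indep B n \<phi> i" "u \<in> nsets B (Suc n)"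
  shows "\<phi> (sel u ({..n} - {i})) = \<phi> (sel u ({..n} - {Suc i}))"
proof -
  have "{..n} - {j} \<in> nsets {..<Suc n} n" if "j \<le> n" for j
    using that unfolding nsets_def by auto
  then show ?thesis
    using assms unfolding coord_indep_def position_invariant_def by (meson Suc_leI less_imp_le_nat)
qed

text \<open>Spreading the sets out over every other element of \<open>B\<close> leaves room to move the image of \<open>m\<close> alone.\<close>

lemma coord_indep_first_difference:
  assumes "position_invariant B n N \<phi>" "2 * n \<le> N" "infinite B"
    "s \<in> nsets B n" "s' \<in> nsets B n" "\<phi> s = \<phi> s'" "m \<in> s" "m \<notin> s'"
  shows "coord_indep B n \<phi> (card (s \<inter> {..<m}))"
proof -
  have s: "finite s" "card s = n" "finite s'" "card s' = n"
    using assms(4,5) unfolding nsets_def by auto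
  define \<sigma>1 where "\<sigma>1 x = enumerate B (2 * x)" for x
  define \<sigma>2 where "\<sigma>2 x = (if x = m then enumerate B (Suc (2 * m)) else enumerate B (2 * x))" for x
  have range: "\<sigma>1 x \<in> B" "\<sigma>2 x \<in> B" for x
    using enumerate_in_set[OF assms(3)] unfolding \<sigma>1_def \<sigma>2_def by auto
  have mono: "strict_mono \<sigma>1" "strict_mono \<sigma>2"
    using assms(3) unfolding \<sigma>1_def \<sigma>2_def by (auto intro!: strict_monoI enumerate_mono)
  have card: "card (s \<union> s') \<le> N"
    using card_Un_le[of s s'] s assms(2) by simp
  have "\<phi> (\<sigma>1 ` s) = \<phi> (\<sigma>1 ` s')" "\<phi> (\<sigma>2 ` s) = \<phi> (\<sigma>2 ` s')"
    using assms(1,4-6) card range mono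
    by (auto intro!: position_invariant_image[of B n N] simp: strict_mono_on_def strict_mono_def)
  \<comment> \<open>As \<open>m\<close> is not in \<open>s'\<close>, both maps agree there; so the
    two images of \<open>s\<close>, which differ in one entry only, get the same value.\<close>
  moreover have "\<sigma>1 ` s' = \<sigma>2 ` s'"
    using assms(8) unfolding \<sigma>1_def \<sigma>2_def by (intro image_cong) auto
  ultimately have eq: "\<phi> (\<sigma>1 ` s) = \<phi> (\<sigma>2 ` s)"
    by simp
  define w where "w = \<sigma>1 ` (s - {m})"
  have inj: "inj \<sigma>1"
    using mono(1) strict_mono_imp_inj_on by blast
  have w: "finite w" "Suc (card w) = n"
    using s card_Suc_Diff1[OF s(1) assms(7)] inj unfolding w_def
    by (simp_all add: card_image inj_on_subset)
  have im: "\<sigma>1 ` s = insert (\<sigma>1 m) w" "\<sigma>2 ` s = insert (\<sigma>2 m) w"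
    using assms(7) unfolding w_def \<sigma>1_def \<sigma>2_def by auto
  have lt: "\<sigma>1 m < \<sigma>2 m"
    using assms(3) unfolding \<sigma>1_def \<sigma>2_def by (auto intro!: enumerate_mono)
  have gap: "x < \<sigma>1 m \<or> \<sigma>2 m < x" if "x \<in> w" for x
    using that assms(3) unfolding w_def \<sigma>1_def \<sigma>2_def by auto
  have "w \<inter> {..<\<sigma>1 m} = \<sigma>1 ` (s \<inter> {..<m})"
    using mono(1) unfolding w_def by (auto simp: strict_mono_less)
  then have card_w: "card (w \<inter> {..<\<sigma>1 m}) = card (s \<inter> {..<m})"
    using inj by (simp add: card_image inj_on_subset)
  have "insert (\<sigma>1 m) (insert (\<sigma>2 m) w) \<in> nsets B (Suc n)"
  proof -
    have "\<sigma>1 m \<notin> w" "\<sigma>2 m \<notin> w" "w \<subseteq> B"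
      using gap lt range by (auto dest: less_asym simp: w_def)
    then show ?thesis
      using w lt range unfolding nsets_def by simp
  qed
  then show ?thesis
    unfolding coord_indep_def
    using sel_adjacent[OF w lt gap] eq im card_w by metis
qed

text \<open>\<open>m\<close> and \<open>m'\<close> are adjacent in \<open>insert m s\<close>:
  deleting \<open>m\<close> gives back \<open>s\<close>, deleting \<open>m'\<close> gives
  \<open>s\<close> with that entry lowered.\<close>

lemma coord_indep_replace:
  assumes "position_invariant B n N \<phi>" "Suc n \<le> N" "coord_indep B n \<phi> (card (s \<inter> {..<m}))"
    "s \<in> nsets B n" "m \<in> B" "m \<notin> s" "m' \<in> s" "m < m'" "\<And>x. x \<in> s \<Longrightarrow> m < x \<Longrightarrow> m' \<le> x"
  shows "\<phi> (insert m (s - {m'})) = \<phi> s"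
proof -
  define w where "w = s - {m'}"
  have s: "finite s" "card s = n" "s \<subseteq> B"
    using assms(4) unfolding nsets_def by auto
  have w: "finite w" "Suc (card w) = n" "insert m' w = s"
    using s card_Suc_Diff1[OF s(1) assms(7)] assms(7) unfolding w_def by auto
  have gap: "x < m \<or> m' < x" if "x \<in> w" for x
    using assms(6) assms(9)[of x] that unfolding w_def by (metis DiffE insertI1 le_neq_implies_less linorder_neqE_nat)
  have eq: "w \<inter> {..<m} = s \<inter> {..<m}"
    using assms(8) unfolding w_def by auto
  have "card (s \<inter> {..<m}) < card s"
    using pos_mono[of m m' s] pos_lt_card[OF s(1) assms(7)] assms(8) unfolding pos_def by simp
  moreover have "insert m s \<in> nsets B (Suc n)"
    using s assms(5,6) unfolding nsets_def by auto
  ultimately have "\<phi> (sel (insert m s) ({..n} - {card (s \<inter> {..<m})}))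
      = \<phi> (sel (insert m s) ({..n} - {Suc (card (s \<inter> {..<m}))}))"
    using coord_indepD[OF assms(1,2) _ assms(3)] s(2) by simp
  then show ?thesis
    using sel_adjacent[OF w(1,2) assms(8) gap] unfolding w(3) eq w_def[symmetric] by simp
qed

text \<open>At the first place where two sets with the same \<phi>-value differ, \<phi> does not depend on the
  coordinate, hence neither does \<psi>, and the larger entry can be lowered to the smaller one.\<close>

lemma coord_indep_determines:
  fixes \<phi> :: "nat set \<Rightarrow> 'b" and \<psi> :: "nat set \<Rightarrow> 'c"
  assumes "infinite B" and inv: "position_invariant B n (2 * n + 1) \<phi>" "position_invariant B n (2 * n + 1) \<psi>"
    and imp: "\<And>i. i < n \<Longrightarrow> coord_indep B n \<phi> i \<Longrightarrow> coord_indep B n \<psi> i"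
    and "s \<in> nsets B n" "s' \<in> nsets B n" "\<phi> s = \<phi> s'"
  shows "\<psi> s = \<psi> s'"
  using assms(5-7)
\<comment> \<open>The sum of all entries drops when an entry is lowered; being symmetric in the two
  sets, it lets \<open>step\<close> serve both orders.\<close>
proof (induction "\<Sum>s + \<Sum>s'" arbitrary: s s' rule: less_induct)
  case less
  have step: "\<psi> t = \<psi> t'"
    if t: "t \<in> nsets B n" "t' \<in> nsets B n" "\<phi> t = \<phi> t'" "\<Sum>t + \<Sum>t' = \<Sum>s + \<Sum>s'"
      and m: "m \<in> t" "m \<notin> t'" "\<And>x. x < m \<Longrightarrow> x \<in> t \<longleftrightarrow> x \<in> t'" for t t' m
  proof -
    have fin: "finite t" "card t = n" "t \<subseteq> B" "finite t'" "card t' = n" "t' \<subseteq> B"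
      using t(1,2) unfolding nsets_def by auto
    have eq: "t' \<inter> {..<m} = t \<inter> {..<m}"
      using m(3) by auto
    \<comment> \<open>Both sets have \<open>n\<close> elements and agree below \<open>m\<close>, so
      \<open>t'\<close> has an element beyond \<open>m\<close> to make up for
      \<open>m\<close>.\<close>
    have "{x \<in> t'. m < x} \<noteq> {}"
    proof
      assume "{x \<in> t'. m < x} = {}"
      then have "t' \<subseteq> t \<inter> {..<m}"
        using m(2,3) by (auto simp: not_less le_less)
      then have "t' \<subset> t"
        using m(1) by auto
      then show False
        using psubset_card_mono[OF fin(1) \<open>t' \<subset> t\<close>] fin by simp
    qed
    then have "Min {x \<in> t'. m < x} \<in> {x \<in> t'. m < x}"
      using fin by (intro Min_in) auto
    then obtain m' where m': "m' \<in> t'" "m < m'" "\<And>x. x \<in> t' \<Longrightarrow> m < x \<Longrightarrow> m' \<le> x"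
      using fin by (metis (mono_tags, lifting) Min_le finite_subset mem_Collect_eq subsetI)
    define t'' where "t'' = insert m (t' - {m'})"
    have ind: "coord_indep B n \<phi> (card (t' \<inter> {..<m}))"
      using coord_indep_first_difference[OF inv(1) _ assms(1) t(1-3) m(1,2)] eq by simp
    moreover have "card (t' \<inter> {..<m}) < n"
      using pos_mono[of m m' t'] pos_lt_card[OF fin(4) m'(1)] m'(2) fin(5) unfolding pos_def by simp
    ultimately have ind': "coord_indep B n \<psi> (card (t' \<inter> {..<m}))"
      using imp by blast
    have mB: "m \<in> B"
      using m(1) fin(3) by auto
    have \<phi>: "\<phi> t'' = \<phi> t'"
      unfolding t''_def by (rule coord_indep_replace[OF inv(1) _ ind t(2) mB m(2) m']) auto
    have \<psi>: "\<psi> t'' = \<psi> t'"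
      unfolding t''_def by (rule coord_indep_replace[OF inv(2) _ ind' t(2) mB m(2) m']) auto
    have "t'' \<in> nsets B n"
      using fin m'(1) m(2) mB card_Suc_Diff1[OF fin(4) m'(1)] unfolding nsets_def t''_def by auto
    moreover have "\<Sum>t'' < \<Sum>t'"
      using m' m(2) fin(4) unfolding t''_def by (simp add: sum.remove[of t' m'])
    ultimately have "\<psi> t = \<psi> t''"
      using less.hyps[of t t''] t \<phi> by simp
    with \<psi> show ?thesis
      by simp
  qed
  show ?case
  proof (cases "s = s'")
    case False
    define m where "m = (LEAST x. (x \<in> s) \<noteq> (x \<in> s'))"
    have ex: "\<exists>x. (x \<in> s) \<noteq> (x \<in> s')"
      using False by blast
    have m: "(m \<in> s) \<noteq> (m \<in> s')"
      unfolding m_def using ex by (rule LeastI_ex)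
    have below: "x \<in> s \<longleftrightarrow> x \<in> s'" if "x < m" for x
      using not_less_Least that unfolding m_def by blast
    show ?thesis
    proof (cases "m \<in> s")
      case True
      then show ?thesis
        using step[of s s' m] less.prems m below by simp
    next
      case False
      then show ?thesis
        using step[of s' s m] less.prems m below by simp
    qed
  qed simp
qed

section \<open>Initial segments and thin sets\<close>

definition init :: "nat \<Rightarrow> nat set \<Rightarrow> nat set"
  where "init j t = {x \<in> t. pos t x < j}"

lemma init_init: "j \<le> k \<Longrightarrow> init j (init k t) = init j t"
proof -
  assume "j \<le> k"
  have "pos (init k t) x = pos t x" if "x \<in> init k t" for x
  proof -
    have "init k t \<inter> {..<x} = t \<inter> {..<x}"
    proof -
      have "pos t y < k" if "y < x" for y
        using pos_mono[of y x t] that \<open>x \<in> init k t\<close> unfolding init_def by simp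
      then show ?thesis
        unfolding init_def by auto
    qed
    then show ?thesis
      unfolding pos_def by simp
  qed
  then show ?thesis
    using \<open>j \<le> k\<close> unfolding init_def by auto
qed

text \<open>Entries are counted from 0: with the first \<open>j\<close> of them fixed, entry number
  \<open>j\<close> has finitely many values. For \<open>j = 0\<close> there are finitely many first
  entries.\<close>

definition thin :: "nat \<Rightarrow> nat set set \<Rightarrow> bool"
  where "thin j Q \<longleftrightarrow> (\<forall>a. finite (init (Suc j) ` {t \<in> Q. init j t = a}))"

lemma thin_subset:
  assumes "thin j Q" "Q' \<subseteq> Q"
  shows "thin j Q'"
  unfolding thin_def
proof
  fix a
  have "init (Suc j) ` {t \<in> Q'. init j t = a} \<subseteq> init (Suc j) ` {t \<in> Q. init j t = a}"
    using assms(2) by (intro image_mono) auto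
  from this assms(1)[unfolded thin_def, rule_format]
  show "finite (init (Suc j) ` {t \<in> Q'. init j t = a})"
    by (rule finite_subset)
qed

text \<open>\<open>E j\<close> collects the coordinates on which the first \<open>j\<close> entries
  of \<open>g s\<close> do not depend. Of the decreasing sets \<open>E 0, ..., E (n + 1)\<close>,
  all inside an \<open>n\<close>-element set, two neighbours agree; there the first \<open>j\<close>
  entries determine the first \<open>j + 1\<close>.\<close>

lemma thin_restriction:
  fixes g :: "nat set \<Rightarrow> nat set"
  assumes "infinite C"
  obtains B j where "B \<subseteq> C" "infinite B" "j \<le> n" "thin j (g ` nsets B n)"
proof -
  \<comment> \<open>\<open>2 * n + 1\<close> bounds both sizes that occur: \<open>2 * n\<close> for
    two \<open>n\<close>-sets together, \<open>n + 1\<close> for one with an extra entry.\<close>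
  obtain B where B: "B \<subseteq> C" "infinite B"
    and inv: "\<And>j. j \<in> {..Suc n} \<Longrightarrow> position_invariant B n (2 * n + 1) (\<lambda>s. init j (g s))"
    by (rule position_invariant_subset[OF assms finite_atMost[of "Suc n"], of n "2 * n + 1" "\<lambda>j s. init j (g s)"])
      (rule that)
  define E where "E j = {i. i < n \<and> coord_indep B n (\<lambda>s. init j (g s)) i}" for j
  have E: "finite (E j)" "E j \<subseteq> {..<n}" for j
    unfolding E_def by auto
  have E_Suc: "E (Suc j) \<subseteq> E j" for j
  proof
    fix i
    assume "i \<in> E (Suc j)"
    then obtain u where i: "i < n" and u: "u \<in> nsets B (Suc n)"
      and eq: "init (Suc j) (g (sel u ({..n} - {i}))) = init (Suc j) (g (sel u ({..n} - {Suc i})))"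
      unfolding E_def coord_indep_def by blast
    have "init j (g (sel u ({..n} - {i}))) = init j (g (sel u ({..n} - {Suc i})))"
      using arg_cong[OF eq, of "init j"] by (simp add: init_init)
    then show "i \<in> E j"
      using i u unfolding E_def coord_indep_def by blast
  qed
  have "\<exists>j\<le>n. E (Suc j) = E j"
  proof (rule ccontr)
    assume "\<not> ?thesis"
    then have psub: "E (Suc j) \<subset> E j" if "j \<le> n" for j
      using E_Suc that by blast
    have "card (E j) + j \<le> n" if "j \<le> Suc n" for j
      using that
    proof (induction j)
      case 0
      then show ?case
        using card_mono[OF _ E(2)[of 0]] by simp
    next
      case (Suc j)
      then show ?case
        using psubset_card_mono[OF E(1) psub[of j]] by simp
    qed
    from this[of "Suc n"] show False
      by simp
  qed
  then obtain j where j: "j \<le> n" "E (Suc j) = E j"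
    by blast
  have det: "init (Suc j) (g s) = init (Suc j) (g s')"
    if "s \<in> nsets B n" "s' \<in> nsets B n" "init j (g s) = init j (g s')" for s s'
    by (rule coord_indep_determines[OF B(2) inv[of j] inv[of "Suc j"] _ that])
      (use j in \<open>auto simp: E_def\<close>)
  have "thin j (g ` nsets B n)"
    unfolding thin_def
  proof
    fix a
    let ?S = "{t \<in> g ` nsets B n. init j t = a}"
    have sub: "init (Suc j) ` ?S \<subseteq> {init (Suc j) x}" if "x \<in> ?S" for x
      using that det by auto
    show "finite (init (Suc j) ` ?S)"
    proof (cases "?S = {}")
      case False
      then obtain x where "x \<in> ?S"
        by blast
      from finite_subset[OF sub[OF this]] show ?thesis
        by simp
    qed (simp only: image_empty finite.emptyI)
  qed
  with B j(1) show thesis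
    using that by blast
qed

subsection \<open>Evading thin sets\<close>

lemma init_subset: "init j t \<subseteq> t"
  unfolding init_def by auto

lemma ex_pos_eq:
  assumes "infinite u"
  obtains x where "x \<in> u" "pos u x = j"
proof
  show "enumerate u j \<in> u"
    using assms by (rule enumerate_in_set)
  have "u \<inter> {..<enumerate u j} = enumerate u ` {..<j}"
  proof
    show "enumerate u ` {..<j} \<subseteq> u \<inter> {..<enumerate u j}"
      using assms enumerate_in_set by auto
    show "u \<inter> {..<enumerate u j} \<subseteq> enumerate u ` {..<j}"
    proof
      fix x
      assume x: "x \<in> u \<inter> {..<enumerate u j}"
      then obtain i where "x = enumerate u i"
        using enumerate_Ex[OF assms, of x] by auto
      with x assms show "x \<in> enumerate u ` {..<j}"
        by auto
    qed
  qed
  then show "pos u (enumerate u j) = j"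
    unfolding pos_def using assms by (simp add: card_image inj_on_subset[OF inj_enumerate])
qed

lemma init_mem_nsets:
  assumes "infinite u"
  shows "init j u \<in> nsets u j"
proof -
  obtain x where x: "x \<in> u" "pos u x = j"
    using assms ex_pos_eq by blast
  have "init j u = u \<inter> {..<x}"
    using x pos_less_iff[of _ u x] unfolding init_def by auto
  then show ?thesis
    using x unfolding nsets_def pos_def by auto
qed

text \<open>All blocks of \<open>n + 1\<close> consecutive elements of \<open>D\<close>. The full
  set of \<open>(n + 1)\<close>-subsets of \<open>D\<close> would not do as \<open>A j\<close>: on
  \<open>D\<close> the identity would converge to \<open>j\<close>.\<close>

definition segments :: "nat \<Rightarrow> nat set \<Rightarrow> nat set set"
  where "segments n D = range (\<lambda>k. init (Suc n) (D \<inter> {k..}))"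

lemma infinite_Int_atLeast:
  fixes D :: "nat set"
  assumes "infinite D"
  shows "infinite (D \<inter> {k..})"
proof
  assume "finite (D \<inter> {k..})"
  then have "finite ((D \<inter> {k..}) \<union> {..<k})"
    by simp
  then have "finite D"
    by (rule finite_subset[rotated]) auto
  then show False
    using assms by simp
qed

lemma segment_nsets:
  assumes "infinite D"
  shows "init (Suc n) (D \<inter> {k..}) \<in> nsets (D \<inter> {k..}) (Suc n)"
  using assms infinite_Int_atLeast init_mem_nsets by blast

lemma segments_subset: "infinite D \<Longrightarrow> segments n D \<subseteq> nsets D (Suc n)"
  using segment_nsets[of D n] nsets_mono[OF Int_lower1] unfolding segments_def by fast

text \<open>A block containing \<open>x\<close> comes from some \<open>k \<le> x\<close>. This
  yields thinness, and in the end it keeps the identity from converging to a point of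
  \<open>J\<close>.\<close>

lemma finite_segments_containing:
  assumes "infinite D"
  shows "finite {t \<in> segments n D. x \<in> t}"
proof -
  have "k \<le> x" if "x \<in> init (Suc n) (D \<inter> {k..})" for k
    using that init_subset by fastforce
  then have "{t \<in> segments n D. x \<in> t} \<subseteq> (\<lambda>k. init (Suc n) (D \<inter> {k..})) ` {..x}"
    unfolding segments_def by auto
  then show ?thesis
    by (rule finite_subset) simp
qed

text \<open>A first entry belongs to finitely many blocks. Being thin, the earlier
  \<open>A i\<close> can be evaded like ranges, which makes the family almost disjoint.\<close>

lemma thin_segments:
  assumes "infinite D"
  shows "thin 1 (segments n D)"
  unfolding thin_def
proof
  fix a
  let ?S = "{t \<in> segments n D. init 1 t = a}"
  have "finite ?S"
  proof (cases "a = {}")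
    case True
    have "init 1 t \<noteq> {}" if "t \<in> segments n D" for t
    proof -
      have t: "finite t" "t \<noteq> {}"
        using that segments_subset[OF assms, of n] unfolding nsets_def by auto
      then have "pos t (Min t) = 0"
        unfolding pos_def by (auto simp: Min_le not_less disjoint_iff card_eq_0_iff)
      then show ?thesis
        using t Min_in unfolding init_def by fastforce
    qed
    then have "?S = {}"
      using True by blast
    then show ?thesis
      by (simp only: finite.emptyI)
  next
    case False
    then obtain x where "x \<in> a"
      by blast
    then have "?S \<subseteq> {t \<in> segments n D. x \<in> t}"
      using init_subset[of 1] by blast
    then show ?thesis
      by (rule finite_subset) (rule finite_segments_containing[OF assms])
  qed
  then show "finite (init (Suc 1) ` ?S)"
    by (rule finite_imageI)
qed

text \<open>Only finitely many sets lie in \<open>{..d}\<close> and each has finitely many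
  continuations, so one number bounds them all.\<close>

lemma thin_bound:
  assumes "thin j Q"
  obtains h where "\<And>d t. t \<in> Q \<Longrightarrow> init j t \<subseteq> {..d} \<Longrightarrow> (\<And>y. y \<in> init (Suc j) t \<Longrightarrow> finite t \<Longrightarrow> y \<le> h (d :: nat))"
proof -
  have "\<exists>b. \<forall>t\<in>Q. finite t \<longrightarrow> init j t \<subseteq> {..d} \<longrightarrow> (\<forall>y\<in>init (Suc j) t. y \<le> b)" for d :: nat
  proof -
    let ?Z = "\<Union>a\<in>Pow {..d}. \<Union>(init (Suc j) ` {t \<in> Q. init j t = a} \<inter> Collect finite)"
    have "finite ?Z"
      using assms unfolding thin_def by auto
    then obtain b where "\<And>z. z \<in> ?Z \<Longrightarrow> z \<le> b"
      by (meson finite_nat_set_iff_bounded_le)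
    moreover have "init (Suc j) t \<subseteq> ?Z" if "t \<in> Q" "finite t" "init j t \<subseteq> {..d}" for t
      using that finite_subset[OF init_subset] by blast
    ultimately show ?thesis
      by (meson subsetD)
  qed
  then obtain h where "\<And>d. \<forall>t\<in>Q. finite t \<longrightarrow> init j t \<subseteq> {..d} \<longrightarrow> (\<forall>y\<in>init (Suc j) t. y \<le> h d)"
    by metis
  then show thesis
    using that by blast
qed

text \<open>\<open>D\<close> is sparse for a function \<open>f\<close> dominating the bounds of all
  \<open>Q\<close>. In a block far out that belongs to \<open>Q\<close>, the critical entry
  \<open>y\<close> with predecessor \<open>d\<close> would satisfy
  \<open>y \<le> h Q d \<le> f d < y\<close>.\<close>

lemma segments_almost_disjoint:
  fixes \<Q> :: "nat set set set"
  assumes card: "|\<Q>| <o bounding_number" and thin: "\<And>Q. Q \<in> \<Q> \<Longrightarrow> \<exists>j\<le>n. thin j Q" and "infinite C"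
  obtains D where "D \<subseteq> C" "infinite D" "\<And>Q. Q \<in> \<Q> \<Longrightarrow> finite (segments n D \<inter> Q)"
proof -
  have "\<exists>j h. j \<le> n \<and> (\<forall>t\<in>Q. \<forall>d. finite t \<longrightarrow> init j t \<subseteq> {..d} \<longrightarrow> (\<forall>y\<in>init (Suc j) t. y \<le> h d))"
    if "Q \<in> \<Q>" for Q
    using thin[OF that] thin_bound by metis
  then obtain j and h :: "nat set set \<Rightarrow> nat \<Rightarrow> nat" where jh: "\<And>Q. Q \<in> \<Q> \<Longrightarrow> j Q \<le> n"
    "\<And>Q t d y. Q \<in> \<Q> \<Longrightarrow> t \<in> Q \<Longrightarrow> finite t \<Longrightarrow> init (j Q) t \<subseteq> {..d} \<Longrightarrow> y \<in> init (Suc (j Q)) t \<Longrightarrow> y \<le> h Q d"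
    by metis
  obtain f where f: "\<And>Q. Q \<in> \<Q> \<Longrightarrow> \<exists>N. \<forall>m\<ge>N. h Q m \<le> f m"
    using dominating_function[OF card] by metis
  obtain D where D: "D \<subseteq> C" "infinite D" "\<And>x y. x \<in> D \<Longrightarrow> y \<in> D \<Longrightarrow> x < y \<Longrightarrow> f x < y"
    using sparse_subset[OF assms(3)] by metis
  have "finite (segments n D \<inter> Q)" if Q: "Q \<in> \<Q>" for Q
  proof -
    obtain N where N: "\<And>m. m \<ge> N \<Longrightarrow> h Q m \<le> f m"
      using f[OF Q] by blast
    \<comment> \<open>\<open>N\<close> makes the domination valid at the predecessor;
      \<open>Suc (h Q 0)\<close> treats \<open>j Q = 0\<close>, where there is no
      predecessor.\<close>
    define M where "M = max N (Suc (h Q 0))"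
    have "init (Suc n) (D \<inter> {k..}) \<notin> Q" if "M \<le> k" for k
    proof
      define t where "t = init (Suc n) (D \<inter> {k..})"
      assume "init (Suc n) (D \<inter> {k..}) \<in> Q"
      then have tQ: "t \<in> Q"
        unfolding t_def .
      have t: "t \<subseteq> D" "t \<subseteq> {k..}" "finite t" "card t = Suc n"
        using segment_nsets[OF D(2), of n k] unfolding t_def nsets_def by auto
      \<comment> \<open>The ranks in a block are \<open>0, ..., n\<close>, so
        \<open>j Q \<le> n\<close> provides the critical entry.\<close>
      obtain y where y: "y \<in> t" "pos t y = j Q"
        using pos_image[OF t(3)] jh(1)[OF Q] t(4) by (metis imageE le_imp_less_Suc lessThan_iff)
      have yi: "y \<in> init (Suc (j Q)) t"
        using y unfolding init_def by simp
      have lt: "x < y" "x \<in> t" if "x \<in> init (j Q) t" for x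
        using that y pos_less_iff[of x t y] unfolding init_def by auto
      show False
      proof (cases "init (j Q) t = {}")
        case True
        then have "y \<le> h Q 0"
          using jh(2)[OF Q tQ t(3) _ yi, of 0] by simp
        then show ?thesis
          using y(1) t(2) \<open>M \<le> k\<close> unfolding M_def by auto
      next
        case False
        define d where "d = Max (init (j Q) t)"
        have fin: "finite (init (j Q) t)"
          using finite_subset[OF init_subset t(3)] .
        have d: "d \<in> init (j Q) t" "init (j Q) t \<subseteq> {..d}"
          using False fin unfolding d_def by auto
        have "y \<le> h Q d"
          by (rule jh(2)[OF Q tQ t(3) d(2) yi])
        also have "\<dots> \<le> f d"
          using N[of d] lt(2)[OF d(1)] t(2) \<open>M \<le> k\<close> unfolding M_def by fastforce
        also have "\<dots> < y"
          using D(3)[of d y] lt[OF d(1)] t(1) y(1) by blast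
        finally show ?thesis
          by simp
      qed
    qed
    then have "k < M" if "init (Suc n) (D \<inter> {k..}) \<in> Q" for k
      using that not_le by blast
    then have "segments n D \<inter> Q \<subseteq> (\<lambda>k. init (Suc n) (D \<inter> {k..})) ` {..<M}"
      unfolding segments_def by auto
    then show ?thesis
      by (rule finite_subset) simp
  qed
  with D(1,2) show thesis
    using that by blast
qed

subsection \<open>Spaces of small character\<close>

lemma nset_converges_to_topspace: "nset_converges_to X n B f p \<Longrightarrow> p \<in> topspace X"
  unfolding nset_converges_to_def by simp

lemma nset_converges_toE:
  assumes "nset_converges_to X n B f p" "openin X U" "p \<in> U"
  obtains F where "finite F" "F \<subseteq> B" "f ` nsets (B - F) n \<subseteq> U"
proof -
  have "\<exists>F. finite F \<and> F \<subseteq> B \<and> f ` nsets (B - F) n \<subseteq> U"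
    using assms unfolding nset_converges_to_def by simp
  with that show thesis
    by auto
qed

lemma nset_converges_to_subset:
  assumes "nset_converges_to X n B f p" "B' \<subseteq> B"
  shows "nset_converges_to X n B' f p"
proof -
  have "\<exists>F'. finite F' \<and> F' \<subseteq> B' \<and> f ` nsets (B' - F') n \<subseteq> U" if U: "openin X U \<and> p \<in> U" for U
  proof -
    obtain F where F: "finite F" "f ` nsets (B - F) n \<subseteq> U"
      using assms(1) U unfolding nset_converges_to_def by blast
    have "nsets (B' - F \<inter> B') n \<subseteq> nsets (B - F) n"
      using assms(2) by (intro nsets_mono) auto
    then show ?thesis
      using F by (intro exI[of _ "F \<inter> B'"]) auto
  qed
  then show ?thesis
    using assms(1) unfolding nset_converges_to_def by auto
qed

lemma nset_convergent_subset: "nset_convergent X n B f \<Longrightarrow> B' \<subseteq> B \<Longrightarrow> nset_convergent X n B' f"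
  using nset_converges_to_subset[of X n B f _ B'] unfolding nset_convergent_def by auto

lemma nset_converges_to_cong:
  assumes "nset_converges_to X n B f p" "\<And>s. s \<in> nsets B n \<Longrightarrow> f s = f' s"
  shows "nset_converges_to X n B f' p"
proof -
  have "f' ` nsets (B - F) n = f ` nsets (B - F) n" for F
    using assms(2) nsets_mono[of "B - F" B n] by (intro image_cong) auto
  then show ?thesis
    using assms(1) unfolding nset_converges_to_def by simp
qed

text \<open>A subbase, because the natural neighbourhoods of infinity are complements of single
  pieces. Intersecting with \<open>topspace X\<close> takes care of an empty
  \<open>\<V>\<close>.\<close>

definition local_subbase :: "'a topology \<Rightarrow> 'a \<Rightarrow> 'a set set \<Rightarrow> bool"
  where "local_subbase X p \<N> \<longleftrightarrow> (\<forall>V\<in>\<N>. openin X V \<and> p \<in> V) \<and>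
    (\<forall>U. openin X U \<and> p \<in> U \<longrightarrow> (\<exists>\<V>. finite \<V> \<and> \<V> \<subseteq> \<N> \<and> topspace X \<inter> \<Inter>\<V> \<subseteq> U))"

text \<open>\<open>A (Suc k)\<close> is chosen above the least element of \<open>A k\<close> so that
  the section at that element converges on it. The least elements form \<open>B\<close>: those after
  the \<open>k\<close>-th all lie in \<open>A (Suc k)\<close>.\<close>

lemma nset_convergent_fusion:
  fixes C :: "nat set" and g :: "nat set \<Rightarrow> 'a"
  assumes IH: "\<And>A f. infinite A \<Longrightarrow> A \<subseteq> C \<Longrightarrow> f \<in> nsets A n \<rightarrow> topspace X \<Longrightarrow>
      \<exists>B\<subseteq>A. infinite B \<and> nset_convergent X n B f"
    and "infinite C" "g \<in> nsets C (Suc n) \<rightarrow> topspace X"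
  obtains B where "B \<subseteq> C" "infinite B" "\<And>m. m \<in> B \<Longrightarrow> nset_convergent X n (B \<inter> {m<..}) (\<lambda>s. g (insert m s))"
proof -
  have step: "\<exists>A'. (infinite A' \<and> A' \<subseteq> C) \<and>
      (A' \<subseteq> A \<inter> {Inf A<..} \<and> nset_convergent X n A' (\<lambda>s. g (insert (Inf A) s)))"
    if A: "infinite A \<and> A \<subseteq> C" for A
  proof -
    have "A \<noteq> {}"
      using A by auto
    then have m: "Inf A \<in> A"
      by (rule Inf_nat_def1)
    have "infinite (A \<inter> {Inf A<..})"
      using infinite_Int_atLeast[of A "Suc (Inf A)"] A by (simp add: atLeast_Suc_greaterThan)
    moreover have "(\<lambda>s. g (insert (Inf A) s)) \<in> nsets (A \<inter> {Inf A<..}) n \<rightarrow> topspace X"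
    proof
      fix s
      assume "s \<in> nsets (A \<inter> {Inf A<..}) n"
      then have "insert (Inf A) s \<in> nsets C (Suc n)"
        using A m unfolding nsets_def by (auto simp: card_insert_if)
      then show "g (insert (Inf A) s) \<in> topspace X"
        using assms(3) by blast
    qed
    moreover have "A \<inter> {Inf A<..} \<subseteq> C"
      using A by blast
    ultimately obtain A' where "A' \<subseteq> A \<inter> {Inf A<..}" "infinite A'" "nset_convergent X n A' (\<lambda>s. g (insert (Inf A) s))"
      using IH by metis
    then show ?thesis
      using A by blast
  qed
  have "\<exists>A. \<forall>k. (infinite (A k) \<and> A k \<subseteq> C) \<and>
      (A (Suc k) \<subseteq> A k \<inter> {Inf (A k)<..} \<and> nset_convergent X n (A (Suc k)) (\<lambda>s. g (insert (Inf (A k)) s)))"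
  proof (rule dependent_nat_choice)
    show "\<exists>A. infinite A \<and> A \<subseteq> C"
      using assms(2) by blast
  qed (rule step)
  then obtain A where A: "\<And>k. infinite (A k) \<and> A k \<subseteq> C"
    "\<And>k. A (Suc k) \<subseteq> A k \<inter> {Inf (A k)<..} \<and> nset_convergent X n (A (Suc k)) (\<lambda>s. g (insert (Inf (A k)) s))"
    by metis
  define m where "m k = Inf (A k)" for k
  have mA: "m k \<in> A k" for k
  proof -
    have "A k \<noteq> {}"
      using A(1)[of k] by auto
    then show ?thesis
      unfolding m_def by (rule Inf_nat_def1)
  qed
  have dec: "A l \<subseteq> A k" if "k \<le> l" for k l
    using lift_Suc_antimono_le[of A, OF _ that] A(2) by blast
  have "m k < m (Suc k)" for k
    using A(2)[of k] mA[of "Suc k"] unfolding m_def by auto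
  then have mono: "strict_mono m"
    by (simp add: strict_mono_Suc_iff)
  show thesis
  proof (rule that[of "range m"])
    show "range m \<subseteq> C"
      using mA A(1) by blast
    show "infinite (range m)"
      using finite_imageD[of m UNIV] strict_mono_imp_inj_on[OF mono] by auto
    fix i
    assume "i \<in> range m"
    then obtain k where k: "i = m k"
      by blast
    have "range m \<inter> {i<..} \<subseteq> A (Suc k)"
    proof
      fix y
      assume "y \<in> range m \<inter> {i<..}"
      then obtain l where l: "y = m l" "m k < m l"
        unfolding k by auto
      then have "Suc k \<le> l"
        using mono by (simp add: strict_mono_less Suc_leI)
      then show "y \<in> A (Suc k)"
        using dec mA[of l] l(1) by blast
    qed
    then show "nset_convergent X n (range m \<inter> {i<..}) (\<lambda>s. g (insert i s))"
      using A(2)[of k] nset_convergent_subset unfolding k m_def by blast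
  qed
qed

text \<open>The limits of the sections of a function of \<open>n + 1\<close> variables form a sequence; a function
  dominating the moduli of convergence of all sections tells how sparse a set has to be so that
  the function itself converges to the limit of that sequence.\<close>

lemma nset_convergent_small_character:
  fixes C :: "nat set" and g :: "nat set \<Rightarrow> 'a"
  assumes seq: "\<And>A x. infinite A \<Longrightarrow> x \<in> A \<rightarrow> topspace X \<Longrightarrow>
      \<exists>B\<subseteq>A. infinite B \<and> (\<exists>p\<in>topspace X. \<forall>U. openin X U \<and> p \<in> U \<longrightarrow> finite {c::nat \<in> B. x c \<notin> U})"
    and base: "\<And>p. p \<in> topspace X \<Longrightarrow> \<exists>\<N>. |\<N>| <o bounding_number \<and> local_subbase X p \<N>"
    and "infinite C" "g \<in> nsets C n \<rightarrow> topspace X"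
  shows "\<exists>B\<subseteq>C. infinite B \<and> nset_convergent X n B g"
  using assms(3,4)
proof (induction n arbitrary: C g)
  case 0
  then have "g {} \<in> topspace X"
    by (simp add: Pi_iff)
  then have "nset_converges_to X 0 C g (g {})"
    unfolding nset_converges_to_def by auto
  then show ?case
    using 0(1) unfolding nset_convergent_def by blast
next
  case (Suc n)
  obtain B where B: "B \<subseteq> C" "infinite B"
    "\<And>m. m \<in> B \<Longrightarrow> nset_convergent X n (B \<inter> {m<..}) (\<lambda>s. g (insert m s))"
    using nset_convergent_fusion[OF Suc.IH Suc.prems] by blast
  then obtain x where x: "\<And>m. m \<in> B \<Longrightarrow> nset_converges_to X n (B \<inter> {m<..}) (\<lambda>s. g (insert m s)) (x m)"
    unfolding nset_convergent_def by metis
  then have "x \<in> B \<rightarrow> topspace X"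
    unfolding nset_converges_to_def by blast
  then obtain B1 p where B1: "B1 \<subseteq> B" "infinite B1" and p: "p \<in> topspace X"
    "\<And>U. openin X U \<Longrightarrow> p \<in> U \<Longrightarrow> finite {c \<in> B1. x c \<notin> U}"
    using seq[OF B(2)] by metis
  obtain \<N> where \<N>: "|\<N>| <o bounding_number" "local_subbase X p \<N>"
    using base[OF p(1)] by blast
  \<comment> \<open>The modulus of convergence: once the limit \<open>x m\<close> is in
    \<open>V\<close>, the section at \<open>m\<close> stays in \<open>V\<close> beyond some
    \<open>b\<close>.\<close>
  have "\<exists>b. \<forall>s\<in>nsets (B \<inter> {m<..} \<inter> {b<..}) n. g (insert m s) \<in> V"
    if V: "V \<in> \<N>" and m: "m \<in> B" "x m \<in> V" for V m
  proof -
    have "openin X V"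
      using \<N>(2) V unfolding local_subbase_def by blast
    then obtain F where F: "finite F" "(\<lambda>s. g (insert m s)) ` nsets (B \<inter> {m<..} - F) n \<subseteq> V"
      using x[OF m(1)] m(2) unfolding nset_converges_to_def by blast
    obtain b where "F \<subseteq> {..b}"
      using F(1) finite_nat_iff_bounded_le by blast
    then have "nsets (B \<inter> {m<..} \<inter> {b<..}) n \<subseteq> nsets (B \<inter> {m<..} - F) n"
      by (intro nsets_mono) auto
    then show ?thesis
      using F(2) by (intro exI[of _ b]) blast
  qed
  then obtain h where h: "\<And>V m s. V \<in> \<N> \<Longrightarrow> m \<in> B \<Longrightarrow> x m \<in> V \<Longrightarrow>
      s \<in> nsets (B \<inter> {m<..} \<inter> {h V m<..}) n \<Longrightarrow> g (insert m s) \<in> V"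
    by metis
  obtain f where f: "\<And>V. V \<in> \<N> \<Longrightarrow> \<exists>N. \<forall>m\<ge>N. h V m \<le> f m"
    by (rule dominating_function[OF \<N>(1), of h]) (rule that)
  obtain B2 where B2: "B2 \<subseteq> B1" "infinite B2" "\<And>x y. x \<in> B2 \<Longrightarrow> y \<in> B2 \<Longrightarrow> x < y \<Longrightarrow> f x < y"
    by (rule sparse_subset[OF B1(2), of f]) (rule that)
  \<comment> \<open>If the least element \<open>m\<close> of \<open>u\<close> is large, then
    \<open>x m\<close> is in \<open>V\<close> and the other entries exceed
    \<open>f m \<ge> h V m\<close>.\<close>
  have "\<exists>N. \<forall>u\<in>nsets (B2 \<inter> {N..}) (Suc n). g u \<in> V" if V: "V \<in> \<N>" for V
  proof -
    obtain N1 where N1: "\<And>m. N1 \<le> m \<Longrightarrow> h V m \<le> f m"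
      using f[OF V] by blast
    have "openin X V" "p \<in> V"
      using \<N>(2) V unfolding local_subbase_def by auto
    then obtain N2 where N2: "{c \<in> B1. x c \<notin> V} \<subseteq> {..<N2}"
      using p(2) finite_nat_iff_bounded by blast
    have "g u \<in> V" if u: "u \<in> nsets (B2 \<inter> {max N1 N2..}) (Suc n)" for u
    proof -
      have fin: "finite u" "u \<noteq> {}" "card u = Suc n" "u \<subseteq> B2" "u \<subseteq> {max N1 N2..}"
        using u unfolding nsets_def by auto
      define m where "m = Min u"
      have m: "m \<in> u" "\<And>y. y \<in> u \<Longrightarrow> m \<le> y"
        using fin unfolding m_def by auto
      have "N1 \<le> m" "N2 \<le> m" "m \<in> B2" "m \<in> B"
        using m(1) fin(4,5) B2(1) B1(1) by auto
      then have xm: "x m \<in> V" and hm: "h V m \<le> f m"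
        using N1 N2 B2(1) by auto
      have "y \<in> B \<inter> {m<..} \<inter> {h V m<..}" if "y \<in> u - {m}" for y
      proof -
        have "m < y" "y \<in> B2"
          using that m(2)[of y] fin(4) by auto
        then show ?thesis
          using B2(3)[OF \<open>m \<in> B2\<close>, of y] hm B2(1) B1(1) by auto
      qed
      then have "u - {m} \<in> nsets (B \<inter> {m<..} \<inter> {h V m<..}) n"
        using fin(1,3) m(1) unfolding nsets_def by auto
      from h[OF V \<open>m \<in> B\<close> xm this] show ?thesis
        using m(1) by (simp add: insert_absorb)
    qed
    then show ?thesis
      by blast
  qed
  then obtain N where N: "\<And>V u. V \<in> \<N> \<Longrightarrow> u \<in> nsets (B2 \<inter> {N V..}) (Suc n) \<Longrightarrow> g u \<in> V"
    by metis
  have "nset_converges_to X (Suc n) B2 g p"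
    unfolding nset_converges_to_def
  proof (intro conjI allI impI)
    fix U
    assume U: "openin X U \<and> p \<in> U"
    obtain \<V> where \<V>: "finite \<V>" "\<V> \<subseteq> \<N>" "topspace X \<inter> \<Inter>\<V> \<subseteq> U"
      using \<N>(2) U unfolding local_subbase_def by blast
    define F where "F = B2 \<inter> (\<Union>V\<in>\<V>. {..<N V})"
    have "g u \<in> U" if u: "u \<in> nsets (B2 - F) (Suc n)" for u
    proof -
      have "g u \<in> V" if "V \<in> \<V>" for V
      proof -
        have "nsets (B2 - F) (Suc n) \<subseteq> nsets (B2 \<inter> {N V..}) (Suc n)"
          using that unfolding F_def by (intro nsets_mono) auto
        then show ?thesis
          using N[of V u] u that \<V>(2) by blast
      qed
      moreover have "nsets (B2 - F) (Suc n) \<subseteq> nsets C (Suc n)"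
        using B2(1) B1(1) B(1) by (intro nsets_mono) auto
      then have "g u \<in> topspace X"
        using Suc.prems(2) u by blast
      ultimately show ?thesis
        using \<V>(3) by blast
    qed
    then show "\<exists>F. finite F \<and> F \<subseteq> B2 \<and> g ` nsets (B2 - F) (Suc n) \<subseteq> U"
      using \<V>(1) by (intro exI[of _ F]) (auto simp: F_def)
  qed (rule p(1))
  then show ?case
    using B2(1,2) B1(1) B(1) unfolding nset_convergent_def by (intro exI[of _ B2]) auto
qed

subsection \<open>The one-point compactification of an almost disjoint family\<close>

text \<open>All points share one type. It will be \<open>nat set\<close>, with the empty set as
  \<open>z\<close>, the \<open>(n + 1)\<close>-sets as \<open>S\<close> and the infinite sets as
  \<open>J\<close>.\<close>

locale almost_disjoint_family =
  fixes z :: 'a and S J :: "'a set" and A :: "'a \<Rightarrow> 'a set"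
  assumes z: "z \<notin> S" "z \<notin> J" and SJ: "S \<inter> J = {}"
    and A_subset: "\<And>j. j \<in> J \<Longrightarrow> A j \<subseteq> S"
    and A_Int: "\<And>j k. j \<in> J \<Longrightarrow> k \<in> J \<Longrightarrow> j \<noteq> k \<Longrightarrow> finite (A j \<inter> A k)"
begin

text \<open>The points of \<open>S\<close> are isolated, \<open>j\<close> is the limit of \<open>A j\<close>, and \<open>z\<close> is the point at infinity.\<close>

definition franklin_open :: "'a set \<Rightarrow> bool"
  where "franklin_open U \<longleftrightarrow> U \<subseteq> insert z (S \<union> J) \<and> (\<forall>j\<in>J \<inter> U. finite (A j - U)) \<and>
    (z \<in> U \<longrightarrow> finite (J - U) \<and> finite (S - U - \<Union>(A ` (J - U))))"

definition franklin :: "'a topology"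
  where "franklin = topology franklin_open"

lemma franklin_openI:
  assumes "U \<subseteq> insert z (S \<union> J)" "\<And>j. j \<in> J \<Longrightarrow> j \<in> U \<Longrightarrow> finite (A j - U)"
    "z \<in> U \<Longrightarrow> finite (J - U)" "z \<in> U \<Longrightarrow> finite (S - U - \<Union>(A ` (J - U)))"
  shows "franklin_open U"
  using assms unfolding franklin_open_def by auto

lemma istopology_franklin_open: "istopology franklin_open"
  unfolding istopology_def
proof (intro conjI allI impI)
  fix U V
  assume U: "franklin_open U" and V: "franklin_open V"
  show "franklin_open (U \<inter> V)"
  proof (rule franklin_openI)
    show "U \<inter> V \<subseteq> insert z (S \<union> J)"
      using U unfolding franklin_open_def by auto
    show "finite (A j - U \<inter> V)" if "j \<in> J" "j \<in> U \<inter> V" for j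
      using that U V unfolding franklin_open_def Diff_Int by auto
    show "finite (J - U \<inter> V)" if "z \<in> U \<inter> V"
      using that U V unfolding franklin_open_def Diff_Int by auto
    show "finite (S - U \<inter> V - \<Union>(A ` (J - U \<inter> V)))" if "z \<in> U \<inter> V"
    proof (rule finite_subset)
      show "S - U \<inter> V - \<Union>(A ` (J - U \<inter> V)) \<subseteq>
          (S - U - \<Union>(A ` (J - U))) \<union> (S - V - \<Union>(A ` (J - V)))"
        by auto
    qed (use that U V in \<open>auto simp: franklin_open_def\<close>)
  qed
next
  fix K
  assume K: "\<forall>U\<in>K. franklin_open U"
  have fin: "finite (A j - \<Union>K)" if j: "j \<in> J" "j \<in> \<Union>K" for j
  proof -
    obtain U where U: "U \<in> K" "j \<in> U"
      using j(2) by blast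
    then have "finite (A j - U)"
      using K j(1) unfolding franklin_open_def by blast
    then show ?thesis
      by (rule finite_subset[rotated]) (use U in auto)
  qed
  show "franklin_open (\<Union>K)"
  proof (rule franklin_openI)
    show "\<Union>K \<subseteq> insert z (S \<union> J)"
      using K unfolding franklin_open_def by blast
    show "finite (A j - \<Union>K)" if "j \<in> J" "j \<in> \<Union>K" for j
      using fin that .
  next
    assume "z \<in> \<Union>K"
    then obtain U where U: "U \<in> K" "z \<in> U"
      by blast
    then have 1: "finite (J - U)" "finite (S - U - \<Union>(A ` (J - U)))"
      using K unfolding franklin_open_def by auto
    show "finite (J - \<Union>K)"
      by (rule finite_subset[OF _ 1(1)]) (use U in auto)
    show "finite (S - \<Union>K - \<Union>(A ` (J - \<Union>K)))"
    proof (rule finite_subset)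
      \<comment> \<open>A point outside \<open>\<Union>K\<close> may lie in an \<open>A j\<close>
        whose \<open>j\<close> is outside \<open>U\<close> but in \<open>\<Union>K\<close>; then it
        belongs to the finite set \<open>A j - \<Union>K\<close>.\<close>
      show "S - \<Union>K - \<Union>(A ` (J - \<Union>K)) \<subseteq>
          (S - U - \<Union>(A ` (J - U))) \<union> (\<Union>j\<in>(J - U) \<inter> \<Union>K. A j - \<Union>K)"
        using U by auto
      show "finite ((S - U - \<Union>(A ` (J - U))) \<union> (\<Union>j\<in>(J - U) \<inter> \<Union>K. A j - \<Union>K))"
        by (intro finite_UnI finite_UN_I) (use 1 fin in auto)
    qed
  qed
qed

lemma openin_franklin: "openin franklin U \<longleftrightarrow> franklin_open U"
  unfolding franklin_def by (simp add: topology_inverse' istopology_franklin_open)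

lemma topspace_franklin: "topspace franklin = insert z (S \<union> J)"
proof -
  have "openin franklin (insert z (S \<union> J))"
    unfolding openin_franklin
  proof (rule franklin_openI)
    fix j
    assume "j \<in> J"
    then have "A j - insert z (S \<union> J) = {}"
      using A_subset by auto
    then show "finite (A j - insert z (S \<union> J))"
      by (simp only: finite.emptyI)
  next
    have "J - insert z (S \<union> J) = {}"
      "S - insert z (S \<union> J) - \<Union>(A ` (J - insert z (S \<union> J))) = {}"
      by auto
    then show "finite (J - insert z (S \<union> J))"
      "finite (S - insert z (S \<union> J) - \<Union>(A ` (J - insert z (S \<union> J))))"
      by (simp_all only: finite.emptyI)
  qed simp
  then show ?thesis
    unfolding topspace_def openin_franklin franklin_open_def by auto
qed

lemma openin_singleton: "t \<in> S \<Longrightarrow> openin franklin {t}"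
  unfolding openin_franklin by (rule franklin_openI) (use z SJ in auto)

lemma openin_limit:
  assumes "j \<in> J" "finite T"
  shows "openin franklin (insert j (A j - T))"
  unfolding openin_franklin
proof (rule franklin_openI)
  show "insert j (A j - T) \<subseteq> insert z (S \<union> J)"
    using assms A_subset by auto
  have "z \<notin> insert j (A j - T)"
    using assms z A_subset by auto
  then show "finite (J - insert j (A j - T))" "finite (S - insert j (A j - T) - \<Union>(A ` (J - insert j (A j - T))))"
    if "z \<in> insert j (A j - T)"
    using that by auto
  fix k
  assume "k \<in> J" "k \<in> insert j (A j - T)"
  then have "k = j"
    using assms(1) A_subset SJ by blast
  then show "finite (A k - insert j (A j - T))"
    by (intro finite_subset[OF _ assms(2)]) auto
qed

lemma openin_Diff_singleton:
  assumes "t \<in> S"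
  shows "openin franklin (topspace franklin - {t})"
  unfolding openin_franklin
proof (rule franklin_openI)
  show "topspace franklin - {t} \<subseteq> insert z (S \<union> J)"
    unfolding topspace_franklin by auto
  show "finite (A j - (topspace franklin - {t}))" if "j \<in> J" for j
    by (rule finite_subset[of _ "{t}"]) (use that A_subset in \<open>auto simp: topspace_franklin\<close>)
  show "finite (J - (topspace franklin - {t}))"
    by (rule finite_subset[of _ "{t}"]) (auto simp: topspace_franklin)
  show "finite (S - (topspace franklin - {t}) - \<Union>(A ` (J - (topspace franklin - {t}))))"
    by (rule finite_subset[of _ "{t}"]) (auto simp: topspace_franklin)
qed

text \<open>Almost disjointness enters here: a limit \<open>k \<noteq> j\<close> stays interior
  because \<open>A k\<close> loses only a finite set. So \<open>insert j (A j)\<close> is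
  clopen.\<close>

lemma openin_Diff_limit:
  assumes "j \<in> J"
  shows "openin franklin (topspace franklin - insert j (A j))"
  unfolding openin_franklin
proof (rule franklin_openI)
  let ?U = "topspace franklin - insert j (A j)"
  show "?U \<subseteq> insert z (S \<union> J)"
    unfolding topspace_franklin by auto
  show "finite (A k - ?U)" if "k \<in> J" "k \<in> ?U" for k
  proof (rule finite_subset)
    show "A k - ?U \<subseteq> insert j (A k \<inter> A j)"
      using that A_subset by (auto simp: topspace_franklin)
    show "finite (insert j (A k \<inter> A j))"
      using A_Int[of k j] that assms by auto
  qed
  have JU: "J - ?U = {j}"
    using assms A_subset[OF assms] SJ unfolding topspace_franklin by auto
  then show "finite (J - ?U)"
    by simp
  have "S - ?U - \<Union>(A ` (J - ?U)) \<subseteq> {j}"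
    unfolding JU by (auto simp: topspace_franklin)
  then show "finite (S - ?U - \<Union>(A ` (J - ?U)))"
    by (rule finite_subset) simp
qed

text \<open>Points other than \<open>z\<close> have the clopen neighbourhoods \<open>{a}\<close> or
  \<open>insert a (A a)\<close>. Of two points, \<open>a\<close> is taken in \<open>S\<close> if
  possible and otherwise in \<open>J\<close>, so that this neighbourhood omits the other
  one.\<close>

lemma Hausdorff_franklin: "Hausdorff_space franklin"
  unfolding Hausdorff_space_def
proof (intro allI impI)
  fix x y
  assume xy: "x \<in> topspace franklin \<and> y \<in> topspace franklin \<and> x \<noteq> y"
  have sep: "\<exists>U V. openin franklin U \<and> openin franklin V \<and> a \<in> U \<and> b \<in> V \<and> disjnt U V"
    if "a \<in> topspace franklin" "b \<in> topspace franklin" "a \<noteq> b" "a \<in> S \<or> a \<in> J \<and> b \<notin> S" for a b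
  proof (cases "a \<in> S")
    case True
    then show ?thesis
      using openin_singleton openin_Diff_singleton that
      by (intro exI[of _ "{a}"] exI[of _ "topspace franklin - {a}"]) (auto simp: disjnt_def)
  next
    case False
    then have "a \<in> J" "b \<notin> S"
      using that by auto
    then show ?thesis
      using openin_limit[of a "{}"] openin_Diff_limit[of a] that A_subset[of a]
      by (intro exI[of _ "insert a (A a)"] exI[of _ "topspace franklin - insert a (A a)"]) (auto simp: disjnt_def)
  qed
  consider "x \<in> S \<or> x \<in> J \<and> y \<notin> S" | "y \<in> S \<or> y \<in> J \<and> x \<notin> S"
    using xy unfolding topspace_franklin by auto
  then show "\<exists>U V. openin franklin U \<and> openin franklin V \<and> x \<in> U \<and> y \<in> V \<and> disjnt U V"
  proof cases
    case 1
    then show ?thesis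
      using sep[of x y] xy by simp
  next
    case 2
    then obtain U V where "openin franklin U" "openin franklin V" "y \<in> U" "x \<in> V" "disjnt U V"
      using sep[of y x] xy by metis
    then show ?thesis
      using disjnt_sym by blast
  qed
qed

text \<open>Unless a value repeats infinitely often, the sequence is finite-to-one. Infinitely many
  terms in one \<open>A j\<close> converge to \<open>j\<close>; otherwise the terms in
  \<open>S\<close>, or else those in \<open>J\<close>, converge to \<open>z\<close>, as a
  neighbourhood of \<open>z\<close> omits finitely many pieces only.\<close>

lemma seq_compact_franklin:
  fixes x :: "nat \<Rightarrow> 'a"
  assumes "infinite C" "x \<in> C \<rightarrow> topspace franklin"
  shows "\<exists>B\<subseteq>C. infinite B \<and> (\<exists>p\<in>topspace franklin. \<forall>U. openin franklin U \<and> p \<in> U \<longrightarrow> finite {c \<in> B. x c \<notin> U})"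
proof (cases "\<exists>v. infinite {c \<in> C. x c = v}")
  case True
  then obtain v where v: "infinite {c \<in> C. x c = v}"
    by blast
  define B where "B = {c \<in> C. x c = v}"
  have "finite {c \<in> B. x c \<notin> U}" if "v \<in> U" for U
  proof -
    have "{c \<in> B. x c \<notin> U} = {}"
      using that unfolding B_def by auto
    then show ?thesis
      by (simp only: finite.emptyI)
  qed
  moreover have "B \<noteq> {}"
    using v unfolding B_def by (metis finite.emptyI)
  then have "v \<in> topspace franklin"
    using assms(2) unfolding B_def by blast
  moreover have "B \<subseteq> C" "infinite B"
    using v unfolding B_def by auto
  ultimately show ?thesis
    by blast
next
  case False
  then have fibre: "finite {c \<in> C. x c \<in> T}" if "finite T" for T
  proof -
    have "{c \<in> C. x c \<in> T} = (\<Union>v\<in>T. {c \<in> C. x c = v})"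
      by auto
    then show ?thesis
      using False that by simp
  qed
  define C1 where "C1 = {c \<in> C. x c \<in> S}"
  show ?thesis
  proof (cases "infinite C1")
    case True
    show ?thesis
    proof (cases "\<exists>j\<in>J. infinite {c \<in> C. x c \<in> A j}")
      case True
      then obtain j where j: "j \<in> J" "infinite {c \<in> C. x c \<in> A j}"
        by blast
      have "finite {c \<in> {c \<in> C. x c \<in> A j}. x c \<notin> U}" if U: "openin franklin U" "j \<in> U" for U
      proof (rule finite_subset)
        show "{c \<in> {c \<in> C. x c \<in> A j}. x c \<notin> U} \<subseteq> {c \<in> C. x c \<in> A j - U}"
          by auto
        show "finite {c \<in> C. x c \<in> A j - U}"
          using U j(1) unfolding openin_franklin franklin_open_def by (intro fibre) auto
      qed
      then show ?thesis
        using j by (intro exI[of _ "{c \<in> C. x c \<in> A j}"]) (auto simp: topspace_franklin intro!: bexI[of _ j])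
    next
      case noj: False
      have "finite {c \<in> C1. x c \<notin> U}" if U: "openin franklin U" "z \<in> U" for U
      proof (rule finite_subset)
        show "{c \<in> C1. x c \<notin> U} \<subseteq> {c \<in> C. x c \<in> S - U - \<Union>(A ` (J - U))} \<union> (\<Union>j\<in>J - U. {c \<in> C. x c \<in> A j})"
          unfolding C1_def by auto
        have "finite (J - U)" and fin: "finite (S - U - \<Union>(A ` (J - U)))"
          using U unfolding openin_franklin franklin_open_def by auto
        then have "finite (\<Union>j\<in>J - U. {c \<in> C. x c \<in> A j})"
          using noj by simp
        then show "finite ({c \<in> C. x c \<in> S - U - \<Union>(A ` (J - U))} \<union> (\<Union>j\<in>J - U. {c \<in> C. x c \<in> A j}))"
          by (intro finite_UnI fibre[OF fin])
      qed
      then show ?thesis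
        using True by (intro exI[of _ C1]) (auto simp: topspace_franklin C1_def intro!: bexI[of _ z])
    qed
  next
    case False
    define C2 where "C2 = {c \<in> C. x c \<in> J}"
    have "C \<subseteq> C1 \<union> C2 \<union> {c \<in> C. x c \<in> {z}}"
      using assms(2) unfolding C1_def C2_def topspace_franklin by auto
    then have "infinite C2"
      using assms(1) False fibre[of "{z}"] finite_subset[of C "C1 \<union> C2 \<union> {c \<in> C. x c \<in> {z}}"] by auto
    moreover have "finite {c \<in> C2. x c \<notin> U}" if U: "openin franklin U" "z \<in> U" for U
    proof (rule finite_subset)
      show "{c \<in> C2. x c \<notin> U} \<subseteq> {c \<in> C. x c \<in> J - U}"
        unfolding C2_def by auto
      show "finite {c \<in> C. x c \<in> J - U}"
        using U unfolding openin_franklin franklin_open_def by (intro fibre) auto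
    qed
    ultimately show ?thesis
      by (intro exI[of _ C2]) (auto simp: topspace_franklin C2_def intro!: bexI[of _ z])
  qed
qed

text \<open>At \<open>z\<close> there is one subbasic set for each point of \<open>S\<close> and of
  \<open>J\<close>, so the size of \<open>J\<close> matters; the other points have countable
  subbases.\<close>

lemma local_subbase_franklin:
  assumes "|J| <o bounding_number" "countable S" "p \<in> topspace franklin"
  shows "\<exists>\<N>. |\<N>| <o bounding_number \<and> local_subbase franklin p \<N>"
proof -
  have card_S: "|f ` S| <o bounding_number" for f :: "'a \<Rightarrow> 'a set"
    using assms(2) by (intro countable_ordLess_bounding_number countable_image)
  consider "p \<in> S" | "p \<in> J" | "p = z"
    using assms(3) unfolding topspace_franklin by blast
  then show ?thesis
  proof cases
    case 1
    have "local_subbase franklin p {{p}}"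
      unfolding local_subbase_def using openin_singleton[OF 1] by (auto intro!: exI[of _ "{{p}}"])
    then show ?thesis
      using countable_ordLess_bounding_number[of "{{p}}"] by auto
  next
    case 2
    define \<N> where "\<N> = insert (insert p (A p)) ((\<lambda>t. insert p (A p - {t})) ` S)"
    have "countable \<N>"
      unfolding \<N>_def using assms(2) by simp
    moreover have "local_subbase franklin p \<N>"
      unfolding local_subbase_def
    proof (intro conjI ballI allI impI)
      fix V
      assume "V \<in> \<N>"
      then show "openin franklin V" "p \<in> V"
        using openin_limit[OF 2, of "{}"] openin_limit[OF 2, of "{_}"] unfolding \<N>_def by auto
    next
      fix U
      assume U: "openin franklin U \<and> p \<in> U"
      define \<V> where "\<V> = insert (insert p (A p)) ((\<lambda>t. insert p (A p - {t})) ` (A p - U))"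
      have "finite \<V>"
        using U 2 unfolding \<V>_def openin_franklin franklin_open_def by simp
      moreover have "\<V> \<subseteq> \<N>"
        using A_subset[OF 2] unfolding \<V>_def \<N>_def by auto
      moreover have "topspace franklin \<inter> \<Inter>\<V> \<subseteq> U"
      proof
        fix y
        assume "y \<in> topspace franklin \<inter> \<Inter>\<V>"
        then have y: "y \<in> V" if "V \<in> \<V>" for V
          using that by blast
        show "y \<in> U"
        proof (rule ccontr)
          assume yU: "y \<notin> U"
          then have "y \<noteq> p"
            using U by blast
          then have "y \<in> A p - U"
            using y[of "insert p (A p)"] yU unfolding \<V>_def by simp
          then have "y \<in> insert p (A p - {y})"
            by (intro y) (simp add: \<V>_def)
          then show False
            using \<open>y \<noteq> p\<close> by simp
        qed
      qed
      ultimately show "\<exists>\<V>. finite \<V> \<and> \<V> \<subseteq> \<N> \<and> topspace franklin \<inter> \<Inter>\<V> \<subseteq> U"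
        by (intro exI[of _ \<V>]) simp
    qed
    ultimately show ?thesis
      using countable_ordLess_bounding_number[of \<N>] by (intro exI[of _ \<N>]) simp
  next
    case 3
    define \<N> where "\<N> = (\<lambda>t. topspace franklin - {t}) ` S \<union> (\<lambda>j. topspace franklin - insert j (A j)) ` J"
    have "|\<N>| <o bounding_number"
      unfolding \<N>_def using card_S image_ordLess_bounding_number[OF assms(1)]
      by (intro Un_ordLess_bounding_number)
    moreover have "local_subbase franklin p \<N>"
      unfolding local_subbase_def
    proof (intro conjI ballI allI impI)
      fix V
      assume V: "V \<in> \<N>"
      then show "openin franklin V"
        using openin_Diff_singleton openin_Diff_limit unfolding \<N>_def by auto
      show "p \<in> V"
        using V z A_subset unfolding \<N>_def 3 topspace_franklin by auto
    next
      fix U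
      assume U: "openin franklin U \<and> p \<in> U"
      define \<V> where "\<V> = (\<lambda>t. topspace franklin - {t}) ` (S - U - \<Union>(A ` (J - U))) \<union>
        (\<lambda>j. topspace franklin - insert j (A j)) ` (J - U)"
      have "finite \<V>"
        using U unfolding \<V>_def 3 openin_franklin franklin_open_def by simp
      moreover have "\<V> \<subseteq> \<N>"
        unfolding \<V>_def \<N>_def by auto
      moreover have "topspace franklin \<inter> \<Inter>\<V> \<subseteq> U"
      proof
        fix y
        assume "y \<in> topspace franklin \<inter> \<Inter>\<V>"
        then have ytop: "y \<in> topspace franklin" and y: "\<And>V. V \<in> \<V> \<Longrightarrow> y \<in> V"
          by auto
        show "y \<in> U"
        proof (rule ccontr)
          assume yU: "y \<notin> U"
          have limit: "y \<notin> insert j (A j)" if "j \<in> J - U" for j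
          proof -
            have "y \<in> topspace franklin - insert j (A j)"
              by (rule y) (use that in \<open>simp add: \<V>_def\<close>)
            then show ?thesis
              by simp
          qed
          have "y \<in> S - U - \<Union>(A ` (J - U))"
            using ytop yU U limit[of y] limit unfolding 3 topspace_franklin by auto
          then have "y \<in> topspace franklin - {y}"
            by (intro y) (simp add: \<V>_def)
          then show False
            by simp
        qed
      qed
      ultimately show "\<exists>\<V>. finite \<V> \<and> \<V> \<subseteq> \<N> \<and> topspace franklin \<inter> \<Inter>\<V> \<subseteq> U"
        by (intro exI[of _ \<V>]) simp
    qed
    ultimately show ?thesis
      by (intro exI[of _ \<N>]) simp
  qed
qed

lemma nset_convergent_franklin:
  fixes C :: "nat set"
  assumes "|J| <o bounding_number" "countable S" "infinite C" "g \<in> nsets C n \<rightarrow> topspace franklin"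
  obtains B where "B \<subseteq> C" "infinite B" "nset_convergent franklin n B g"
  using nset_convergent_small_character[OF seq_compact_franklin local_subbase_franklin[OF assms(1,2)] assms(3,4)]
  by metis

end

lemma countable_nsets: "countable (nsets (B :: nat set) n)"
proof (rule countable_subset)
  show "nsets B n \<subseteq> {X. finite X}"
    unfolding nsets_def by auto
qed (rule countable_Collect_finite)

section \<open>Convergence in larger families and sequential compactness\<close>

context almost_disjoint_family
begin

text \<open>A neighbourhood of \<open>z\<close> may omit an infinite \<open>A k\<close> with
  \<open>k\<close> outside \<open>J'\<close>, so its trace need not be open in the smaller space.
  But such an \<open>A k\<close> meets the range of \<open>g\<close> in finitely many isolated
  points, which can be removed instead.\<close>

lemma nset_convergent_extend:
  assumes "J' \<subseteq> J" "\<And>j. j \<in> J' \<Longrightarrow> A' j = A j"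
    and conv: "nset_convergent (almost_disjoint_family.franklin z S J' A') n B g"
    and gS: "g ` nsets B n \<subseteq> S"
    and ad: "\<And>k. k \<in> J - J' \<Longrightarrow> finite (A k \<inter> g ` nsets B n)"
  shows "nset_convergent franklin n B g"
proof -
  interpret sub: almost_disjoint_family z S J' A'
  proof
    show "z \<notin> S" "z \<notin> J'" "S \<inter> J' = {}"
      using z SJ assms(1) by auto
    show "A' j \<subseteq> S" if "j \<in> J'" for j
      using A_subset[of j] assms(1,2) that by auto
    show "finite (A' j \<inter> A' k)" if "j \<in> J'" "k \<in> J'" "j \<noteq> k" for j k
      using A_Int[of j k] assms(1,2) that by auto
  qed
  obtain p where p: "nset_converges_to sub.franklin n B g p"
    using conv unfolding nset_convergent_def by blast
  have "nset_converges_to franklin n B g p"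
    unfolding nset_converges_to_def
  proof (intro conjI allI impI)
    show "p \<in> topspace franklin"
      using nset_converges_to_topspace[OF p] assms(1) unfolding sub.topspace_franklin topspace_franklin by auto
    fix U
    assume U: "openin franklin U \<and> p \<in> U"
    have "\<exists>V. openin sub.franklin V \<and> p \<in> V \<and> V \<inter> g ` nsets B n \<subseteq> U"
    proof (cases "p = z")
      case False
      have "openin sub.franklin (U \<inter> (S \<union> J'))"
        unfolding sub.openin_franklin
      proof (rule sub.franklin_openI)
        fix j
        assume j: "j \<in> J'" "j \<in> U \<inter> (S \<union> J')"
        then have "finite (A j - U)"
          using U assms(1) unfolding openin_franklin franklin_open_def by blast
        moreover have "A' j - U \<inter> (S \<union> J') = A j - U"
          using j sub.A_subset[OF j(1)] assms(2)[OF j(1)] by auto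
        ultimately show "finite (A' j - U \<inter> (S \<union> J'))"
          by simp
      qed (use z assms(1) in auto)
      moreover have "p \<in> S \<union> J'"
        using nset_converges_to_topspace[OF p] False unfolding sub.topspace_franklin by auto
      ultimately show ?thesis
        using U by (intro exI[of _ "U \<inter> (S \<union> J')"]) auto
    next
      case True
      define K where "K = J - U"
      define T where "T = (S - U - \<Union>(A ` K)) \<union> (\<Union>k\<in>K - J'. A k \<inter> g ` nsets B n)"
      have K: "finite K" "finite (S - U - \<Union>(A ` K))"
        using U True unfolding K_def openin_franklin franklin_open_def by auto
      then have T: "finite T"
        unfolding T_def using ad by (intro finite_UnI finite_UN_I) (auto simp: K_def)
      define V where "V = insert z (S \<union> J') - (K \<inter> J') - \<Union>(A ` (K \<inter> J')) - (T \<inter> S)"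
      have JV: "J' - V = K \<inter> J'"
        using assms(1) SJ A_subset unfolding V_def K_def by fast
      have "openin sub.franklin V"
        unfolding sub.openin_franklin
      proof (rule sub.franklin_openI)
        show "V \<subseteq> insert z (S \<union> J')"
          unfolding V_def by auto
        show "finite (J' - V)"
          unfolding JV using K(1) by simp
        show "finite (S - V - \<Union>(A' ` (J' - V)))"
        proof (rule finite_subset[OF _ T])
          show "S - V - \<Union>(A' ` (J' - V)) \<subseteq> T"
            unfolding JV using assms(1,2) SJ unfolding V_def by auto
        qed
        fix j
        assume j: "j \<in> J'" "j \<in> V"
        show "finite (A' j - V)"
        proof (rule finite_subset)
          show "A' j - V \<subseteq> (\<Union>k\<in>K \<inter> J'. A' j \<inter> A' k) \<union> T"
            using sub.A_subset[OF j(1)] assms(1,2) SJ unfolding V_def by auto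
          have "finite (A' j \<inter> A' k)" if "k \<in> K \<inter> J'" for k
            using sub.A_Int[of j k] j that unfolding V_def by auto
          then show "finite ((\<Union>k\<in>K \<inter> J'. A' j \<inter> A' k) \<union> T)"
            using K(1) T by (intro finite_UnI finite_UN_I) auto
        qed
      qed
      moreover have "p \<in> V"
        using z A_subset assms(1) unfolding True V_def K_def by auto
      moreover have "V \<inter> g ` nsets B n \<subseteq> U"
      proof
        fix y
        assume y: "y \<in> V \<inter> g ` nsets B n"
        then have "y \<in> S"
          using gS by blast
        show "y \<in> U"
        proof (rule ccontr)
          assume "y \<notin> U"
          moreover have "y \<notin> T"
            using y \<open>y \<in> S\<close> unfolding V_def by blast
          ultimately obtain k where "k \<in> K" "y \<in> A k"
            using \<open>y \<in> S\<close> unfolding T_def by blast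
          then show False
            using y \<open>y \<notin> T\<close> unfolding V_def T_def by blast
        qed
      qed
      ultimately show ?thesis
        by blast
    qed
    then obtain V where V: "openin sub.franklin V" "p \<in> V" "V \<inter> g ` nsets B n \<subseteq> U"
      by blast
    obtain F where F: "finite F" "F \<subseteq> B" "g ` nsets (B - F) n \<subseteq> V"
      by (rule nset_converges_toE[OF p V(1,2)])
    have "g ` nsets (B - F) n \<subseteq> g ` nsets B n"
      by (intro image_mono nsets_mono) auto
    then show "\<exists>F. finite F \<and> F \<subseteq> B \<and> g ` nsets (B - F) n \<subseteq> U"
      using F V(3) by (intro exI[of _ F]) blast
  qed
  then show ?thesis
    unfolding nset_convergent_def by blast
qed

text \<open>Countably many limits occur as values; together with \<open>z\<close> they form the
  one-point compactification of a discrete set, which is the space of a family of empty sets and has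
  small character.\<close>

lemma nset_convergent_limits:
  fixes C :: "nat set"
  assumes "infinite C" "g \<in> nsets C n \<rightarrow> J"
  obtains B where "B \<subseteq> C" "infinite B" "nset_convergent franklin n B g"
proof -
  define Y where "Y = g ` nsets C n"
  have Y: "Y \<subseteq> J" "countable Y"
    using assms(2) countable_nsets unfolding Y_def by auto
  interpret sub: almost_disjoint_family z "{}" Y "\<lambda>_. {}"
    by unfold_locales (use Y(1) z in auto)
  have "g \<in> nsets C n \<rightarrow> topspace sub.franklin"
    unfolding sub.topspace_franklin by (auto simp: Y_def)
  then obtain B where B: "B \<subseteq> C" "infinite B" "nset_convergent sub.franklin n B g"
    using sub.nset_convergent_franklin[OF countable_ordLess_bounding_number[OF Y(2)] _ assms(1)] countable_empty
    by metis
  then obtain p where p: "nset_converges_to sub.franklin n B g p"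
    unfolding nset_convergent_def by blast
  have "nset_converges_to franklin n B g p"
    unfolding nset_converges_to_def
  proof (intro conjI allI impI)
    show "p \<in> topspace franklin"
      using nset_converges_to_topspace[OF p] Y(1) unfolding sub.topspace_franklin topspace_franklin by auto
    fix U
    assume U: "openin franklin U \<and> p \<in> U"
    have V: "openin sub.franklin (U \<inter> insert z Y)"
      unfolding sub.openin_franklin
    proof (rule sub.franklin_openI)
      assume "z \<in> U \<inter> insert z Y"
      then have "finite (J - U)"
        using U unfolding openin_franklin franklin_open_def by blast
      then show "finite (Y - U \<inter> insert z Y)"
        by (rule finite_subset[rotated]) (use Y(1) in auto)
    qed auto
    have pV: "p \<in> U \<inter> insert z Y"
      using nset_converges_to_topspace[OF p] U unfolding sub.topspace_franklin by auto
    obtain F where "finite F" "F \<subseteq> B" "g ` nsets (B - F) n \<subseteq> U \<inter> insert z Y"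
      by (rule nset_converges_toE[OF p V pV])
    then show "\<exists>F. finite F \<and> F \<subseteq> B \<and> g ` nsets (B - F) n \<subseteq> U"
      by (intro exI[of _ F]) simp
  qed
  with B(1,2) show thesis
    using that[of B] unfolding nset_convergent_def by blast
qed

text \<open>The hypothesis concerns functions on all \<open>n\<close>-subsets, so values outside
  \<open>S\<close> are first replaced by \<open>s0\<close>; on the set obtained, Ramsey then decides
  which kind of point \<open>h\<close> takes as values.\<close>

lemma n_sequentially_compact_franklin:
  assumes isolated: "\<And>g. g \<in> nsets (UNIV :: nat set) n \<rightarrow> S \<Longrightarrow> \<exists>B. infinite B \<and> nset_convergent franklin n B g"
    and "S \<noteq> {}"
  shows "n_sequentially_compact n franklin"
  unfolding n_sequentially_compact_def
proof
  fix h :: "nat set \<Rightarrow> 'a"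
  assume h: "h \<in> nsets UNIV n \<rightarrow> topspace franklin"
  obtain s0 where s0: "s0 \<in> S"
    using assms(2) by blast
  define g where "g s = (if h s \<in> S then h s else s0)" for s
  have "g \<in> nsets UNIV n \<rightarrow> S"
    using s0 unfolding g_def by auto
  then obtain B where B: "infinite B" "nset_convergent franklin n B g"
    using isolated by blast
  obtain B' t where B': "B' \<subseteq> B" "infinite B'" "\<And>s. s \<in> nsets B' n \<Longrightarrow> (h s \<in> S, h s \<in> J) = t"
    by (rule Ramsey_finite_colours[OF B(1), of UNIV "\<lambda>s. (h s \<in> S, h s \<in> J)" n]) (auto intro: that)
  have htop: "h s \<in> topspace franklin" if "s \<in> nsets B' n" for s
    using h that nsets_mono[of B' UNIV n] by blast
  consider "fst t" | "\<not> fst t" "snd t" | "\<not> fst t" "\<not> snd t"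
    by blast
  then show "\<exists>B. infinite B \<and> nset_convergent franklin n B h"
  proof cases
    case 1
    then have eq: "g s = h s" if "s \<in> nsets B' n" for s
      using B'(3)[OF that] unfolding g_def by auto
    obtain p where "nset_converges_to franklin n B' g p"
      using nset_convergent_subset[OF B(2) B'(1)] unfolding nset_convergent_def by blast
    then have "nset_converges_to franklin n B' h p"
      by (rule nset_converges_to_cong) (rule eq)
    then show ?thesis
      using B'(2) unfolding nset_convergent_def by blast
  next
    case 2
    then have "h \<in> nsets B' n \<rightarrow> J"
      using B'(3) by fastforce
    then show ?thesis
      using nset_convergent_limits[OF B'(2)] by metis
  next
    case 3
    then have eq: "h s = z" if "s \<in> nsets B' n" for s
      using htop[OF that] B'(3)[OF that] unfolding topspace_franklin by auto
    have "nset_converges_to franklin n B' (\<lambda>_. z) z"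
      unfolding nset_converges_to_def topspace_franklin by (auto intro!: exI[of _ "{}"])
    then have "nset_converges_to franklin n B' h z"
      by (rule nset_converges_to_cong) (simp add: eq)
    then show ?thesis
      using B'(2) unfolding nset_convergent_def by blast
  qed
qed

end

text \<open>Domain and target are countable, so a function amounts to a map from naturals to
  naturals, whose encoded graph is infinite. Other sets decode to arbitrary functions with values in
  the target.\<close>

lemma nset_function_codes:
  fixes n m :: nat
  obtains G :: "nat set \<Rightarrow> nat set \<Rightarrow> nat set" where
    "\<And>j s. G j s \<in> nsets UNIV m"
    "\<And>g. g \<in> nsets UNIV n \<rightarrow> nsets UNIV m \<Longrightarrow> \<exists>j. infinite j \<and> (\<forall>s\<in>nsets UNIV n. G j s = g s)"
proof -
  define P S :: "nat set set" where "P = nsets UNIV n" and "S = nsets UNIV m"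
  define graph :: "(nat \<Rightarrow> nat) \<Rightarrow> nat set" where "graph \<phi> = range (\<lambda>k. prod_encode (k, \<phi> k))" for \<phi>
  have cnt: "countable P" "countable S"
    unfolding P_def S_def by (rule countable_nsets)+
  have "{..<m} \<in> S"
    unfolding S_def nsets_def by simp
  then have S: "S \<noteq> {}"
    by blast
  have inj: "inj graph"
  proof (rule injI)
    fix \<phi> \<psi>
    assume "graph \<phi> = graph \<psi>"
    then have "prod_encode (k, \<phi> k) \<in> graph \<psi>" for k
      unfolding graph_def by blast
    then have "\<exists>l. prod_encode (k, \<phi> k) = prod_encode (l, \<psi> l)" for k
      unfolding graph_def by (simp add: image_iff)
    then have "\<phi> k = \<psi> k" for k
      by (simp add: prod_encode_eq)
    then show "\<phi> = \<psi>"
      by blast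
  qed
  have inf: "infinite (graph \<phi>)" for \<phi>
    unfolding graph_def by (rule range_inj_infinite) (auto intro: injI simp: prod_encode_eq)
  define G where "G j s = from_nat_into S (inv graph j (to_nat_on P s))" for j s
  show thesis
  proof (rule that[of G])
    show "G j s \<in> nsets UNIV m" for j s
      unfolding G_def S_def[symmetric] by (rule from_nat_into[OF S])
    fix g :: "nat set \<Rightarrow> nat set"
    assume g: "g \<in> nsets UNIV n \<rightarrow> nsets UNIV m"
    define \<phi> where "\<phi> k = to_nat_on S (g (from_nat_into P k))" for k
    have "G (graph \<phi>) s = g s" if "s \<in> P" for s
    proof -
      have "g s \<in> S"
        using g that unfolding P_def S_def by blast
      then show ?thesis
        unfolding G_def \<phi>_def inv_f_f[OF inj] using that cnt by simp
    qed
    then show "\<exists>j. infinite j \<and> (\<forall>s\<in>nsets UNIV n. G j s = g s)"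
      using inf unfolding P_def by (intro exI[of _ "graph \<phi>"]) simp
  qed
qed

subsection \<open>The diagonal construction\<close>

text \<open>A cardinal is a well-order of least type, so its proper initial segments are strictly
  smaller than continuum, that is, than b.\<close>

lemma card_underS_infinite_nat_sets:
  assumes "bounding_number =o |UNIV :: real set|" "infinite (j :: nat set)"
  shows "|underS |Collect infinite :: nat set set| j| <o bounding_number"
proof -
  have "|underS |Collect infinite :: nat set set| j| <o |Collect infinite :: nat set set|"
    by (rule card_of_underS) (use assms(2) in \<open>simp_all add: card_of_card_order_on Field_card_of\<close>)
  also have "|Collect infinite :: nat set set| \<le>o |UNIV :: nat set set|"
    by (rule card_of_mono1) simp
  also have "|UNIV :: nat set set| =o |UNIV :: real set|"
    using nat_sets_eqpoll_reals unfolding eqpoll_iff_card_of_ordIso .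
  also have "|UNIV :: real set| =o bounding_number"
    using assms(1) by (rule ordIso_symmetric)
  finally show ?thesis .
qed

text \<open>The recursion controls \<open>A j\<close> only against earlier sets; totality of the
  order makes this symmetric.\<close>

lemma almost_disjoint_family_segments:
  fixes r :: "(nat set \<times> nat set) set"
  assumes "\<And>j. j \<in> J \<Longrightarrow> infinite j" "\<And>j. j \<in> J \<Longrightarrow> \<exists>D\<subseteq>j. infinite D \<and> A j = segments n D"
    and ad: "\<And>i j. i \<in> J \<Longrightarrow> j \<in> J \<Longrightarrow> i \<in> underS r j \<Longrightarrow> finite (A j \<inter> A i)"
    and total: "\<And>i j. i \<in> J \<Longrightarrow> j \<in> J \<Longrightarrow> i \<noteq> j \<Longrightarrow> i \<in> underS r j \<or> j \<in> underS r i"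
  shows "almost_disjoint_family {} (nsets UNIV (Suc n)) J A"
proof
  show "{} \<notin> nsets (UNIV :: nat set) (Suc n)" "{} \<notin> J" "nsets UNIV (Suc n) \<inter> J = {}"
    using assms(1) unfolding nsets_def by auto
  show "A j \<subseteq> nsets UNIV (Suc n)" if j: "j \<in> J" for j
  proof -
    obtain D where D: "infinite D" "A j = segments n D"
      using assms(2)[OF j] by blast
    then show ?thesis
      using segments_subset[OF D(1), of n] nsets_mono[OF subset_UNIV, of D "Suc n"] by simp
  qed
  show "finite (A j \<inter> A k)" if "j \<in> J" "k \<in> J" "j \<noteq> k" for j k
    using total[OF that] ad[of j k] ad[of k j] that by (auto simp: Int_commute)
qed

text \<open>\<open>G j\<close> converges first in the space over \<open>u j\<close>. Since
  \<open>A j\<close> and all later sets almost avoid its range, the convergence survives in the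
  final space.\<close>

lemma diagonal_family:
  fixes G :: "nat set \<Rightarrow> nat set \<Rightarrow> nat set"
  assumes b: "bounding_number =o |UNIV :: real set|" and n: "n \<ge> 1"
    and G: "\<And>j s. G j s \<in> nsets UNIV (Suc n)"
  obtains A :: "nat set \<Rightarrow> nat set set" where
    "almost_disjoint_family {} (nsets UNIV (Suc n)) (Collect infinite) A"
    "\<And>j. infinite j \<Longrightarrow> \<exists>D\<subseteq>j. infinite D \<and> A j = segments n D"
    "\<And>j. infinite j \<Longrightarrow> \<exists>B. infinite B \<and>
      nset_convergent (almost_disjoint_family.franklin {} (nsets UNIV (Suc n)) (Collect infinite) A) n B (G j)"
proof -
  define J :: "nat set set" where "J = Collect infinite"
  define S :: "nat set set" where "S = nsets UNIV (Suc n)"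
  define r where "r = |J|"
  define u where "u = underS r"
  \<comment> \<open>cut off outside \<open>u j\<close>, so that \<open>P f j\<close> below depends on earlier values of \<open>f\<close> only\<close>
  define fs :: "(nat set \<Rightarrow> nat set set \<times> nat set) \<Rightarrow> nat set \<Rightarrow> nat set \<Rightarrow> nat set set"
    where "fs f j i = (if i \<in> u j then fst (f i) else {})" for f j i
  \<comment> \<open>\<open>AB\<close> pairs \<open>A j\<close> with the set on which
    \<open>G j\<close> converges. Convergence is demanded on the proviso that the earlier sets are
    almost disjoint, which is settled after the recursion. The last clause is there because
    \<open>j\<close> is not in \<open>u j\<close>.\<close>
  define P where "P f j AB \<longleftrightarrow> (j \<in> J \<longrightarrow> infinite (snd AB) \<and>
      (\<exists>k\<le>n. thin k (G j ` nsets (snd AB) n)) \<and>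
      (almost_disjoint_family {} S (u j) (fs f j) \<longrightarrow>
        nset_convergent (almost_disjoint_family.franklin {} S (u j) (fs f j)) n (snd AB) (G j)) \<and>
      (\<exists>D\<subseteq>j. infinite D \<and> fst AB = segments n D) \<and>
      (\<forall>i\<in>u j. finite (fst AB \<inter> fst (f i)) \<and> finite (fst AB \<inter> G i ` nsets (snd (f i)) n)) \<and>
      finite (fst AB \<inter> G j ` nsets (snd AB) n))"
    for f :: "nat set \<Rightarrow> nat set set \<times> nat set" and j AB
  have wo: "Well_order r" "Field r = J"
    unfolding r_def by (simp_all add: card_of_well_order_on Field_card_of)
  have u_iff: "i \<in> u j \<longleftrightarrow> (i, j) \<in> r - Id" for i j
    unfolding u_def underS_def by auto
  have uJ: "u j \<subseteq> J" for j
    using wo(2) unfolding u_iff[abs_def] by (auto simp: u_iff Field_def)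
  have total: "i \<in> u j \<or> j \<in> u i" if "i \<in> J" "j \<in> J" "i \<noteq> j" for i j
    using wo that unfolding u_iff well_order_on_def linear_order_on_def total_on_def by auto
  have wf: "wf (r - Id)"
    using wo(1) unfolding well_order_on_def by blast
  have card_u: "|u j| <o bounding_number" if "j \<in> J" for j
    using card_underS_infinite_nat_sets[OF b, of j] that unfolding u_def r_def J_def by simp
  have GS: "G j s \<in> S" for j s
    unfolding S_def by (rule G)
  have cS: "countable S"
    unfolding S_def by (rule countable_nsets)
  have "\<exists>f. \<forall>j. P f j (f j)"
  proof (rule dependent_wf_choice[OF wf])
    fix f g :: "nat set \<Rightarrow> nat set set \<times> nat set" and j AB
    assume "\<And>i. (i, j) \<in> r - Id \<Longrightarrow> f i = g i"
    then have eq: "f i = g i" if "i \<in> u j" for i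
      using that unfolding u_iff by blast
    have "fs f j = fs g j"
      by (rule ext) (simp add: fs_def eq)
    then show "P f j AB = P g j AB"
      unfolding P_def by (simp add: eq)
  next
    fix j and f :: "nat set \<Rightarrow> nat set set \<times> nat set"
    assume IH: "\<And>i. (i, j) \<in> r - Id \<Longrightarrow> P f i (f i)"
    show "\<exists>AB. P f j AB"
    proof (cases "j \<in> J")
      case True
      obtain B0 k where B0: "infinite B0" "k \<le> n" "thin k (G j ` nsets B0 n)"
        by (rule thin_restriction[OF infinite_UNIV_nat, of n "G j"]) (rule that)
      have "\<exists>B\<subseteq>B0. infinite B \<and> (almost_disjoint_family {} S (u j) (fs f j) \<longrightarrow>
        nset_convergent (almost_disjoint_family.franklin {} S (u j) (fs f j)) n B (G j))"
      proof (cases "almost_disjoint_family {} S (u j) (fs f j)")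
        case ad: True
        interpret sub: almost_disjoint_family "{}" S "u j" "fs f j"
          by (rule ad)
        have "G j \<in> nsets B0 n \<rightarrow> topspace sub.franklin"
          unfolding sub.topspace_franklin by (simp add: GS)
        then show ?thesis
          using sub.nset_convergent_franklin[OF card_u[OF True] cS B0(1)] by metis
      next
        case False
        then show ?thesis
          using B0(1) by blast
      qed
      then obtain B where B: "B \<subseteq> B0" "infinite B" "almost_disjoint_family {} S (u j) (fs f j) \<longrightarrow>
        nset_convergent (almost_disjoint_family.franklin {} S (u j) (fs f j)) n B (G j)"
        by blast
      have thinB: "thin k (G j ` nsets B n)"
        using B0(3) by (rule thin_subset) (intro image_mono nsets_mono B(1))
      \<comment> \<open>All that \<open>A j\<close> has to evade: the range just fixed, the earlier
        sets and the earlier ranges.\<close>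
      define \<Q> where "\<Q> = insert (G j ` nsets B n) ((\<lambda>i. fst (f i)) ` u j \<union> (\<lambda>i. G i ` nsets (snd (f i)) n) ` u j)"
      have "|{G j ` nsets B n} \<union> ((\<lambda>i. fst (f i)) ` u j \<union> (\<lambda>i. G i ` nsets (snd (f i)) n) ` u j)| <o bounding_number"
        by (intro Un_ordLess_bounding_number image_ordLess_bounding_number card_u[OF True]
            countable_ordLess_bounding_number) simp
      then have card: "|\<Q>| <o bounding_number"
        unfolding \<Q>_def by simp
      have thin: "\<exists>k\<le>n. thin k Q" if Q: "Q \<in> \<Q>" for Q
      proof -
        have old: "(\<exists>k\<le>n. thin k (fst (f i))) \<and> (\<exists>k\<le>n. thin k (G i ` nsets (snd (f i)) n))" if i: "i \<in> u j" for i
        proof -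
          have Pi: "P f i (f i)"
            using IH[of i] i unfolding u_iff by blast
          have iJ: "i \<in> J"
            using i uJ by blast
          with Pi obtain D where "infinite D" "fst (f i) = segments n D"
            unfolding P_def by blast
          then have "thin 1 (fst (f i))"
            using thin_segments by simp
          then show ?thesis
            using Pi iJ n unfolding P_def by blast
        qed
        from Q consider "Q = G j ` nsets B n" | i where "i \<in> u j" "Q = fst (f i) \<or> Q = G i ` nsets (snd (f i)) n"
          unfolding \<Q>_def by blast
        then show ?thesis
        proof cases
          case 1
          then show ?thesis
            using thinB B0(2) by blast
        next
          case 2
          then show ?thesis
            using old by blast
        qed
      qed
      have inf: "infinite j"
        using True unfolding J_def by simp
      obtain D where D: "D \<subseteq> j" "infinite D" "\<And>Q. Q \<in> \<Q> \<Longrightarrow> finite (segments n D \<inter> Q)"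
        by (rule segments_almost_disjoint[OF card thin inf], assumption) (rule that)
      have "P f j (segments n D, B)"
        unfolding P_def fst_conv snd_conv
      proof (intro impI conjI ballI)
        show "\<exists>k\<le>n. thin k (G j ` nsets B n)"
          using thinB B0(2) by blast
        show "\<exists>D'\<subseteq>j. infinite D' \<and> segments n D = segments n D'"
          using D(1,2) by blast
        show "finite (segments n D \<inter> G j ` nsets B n)"
          by (rule D(3)) (simp add: \<Q>_def)
        show "finite (segments n D \<inter> fst (f i))" "finite (segments n D \<inter> G i ` nsets (snd (f i)) n)"
          if "i \<in> u j" for i
          by (rule D(3), use that in \<open>simp add: \<Q>_def\<close>)+
      qed (use B in blast)+
      then show ?thesis
        by blast
    qed (simp add: P_def)
  qed
  then obtain f where f: "\<And>j. P f j (f j)"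
    by blast
  define A where "A j = fst (f j)" for j
  have seg: "\<exists>D\<subseteq>j. infinite D \<and> A j = segments n D" if "j \<in> J" for j
    using f[of j] that unfolding P_def A_def by blast
  have AA: "finite (A j \<inter> A i)" if "j \<in> J" "i \<in> u j" for i j
    using f[of j] that unfolding P_def A_def by blast
  have AQ: "finite (A j \<inter> G i ` nsets (snd (f i)) n)" if "j \<in> J" "i \<in> u j \<or> i = j" for i j
    using f[of j] that unfolding P_def A_def by blast
  interpret almost_disjoint_family "{}" S J A
    unfolding S_def
  proof (rule almost_disjoint_family_segments[where r = r])
    show "infinite j" if "j \<in> J" for j
      using that unfolding J_def by simp
  qed (use seg AA total in \<open>simp_all add: u_def\<close>)
  have "nset_convergent franklin n (snd (f j)) (G j)" if j: "j \<in> J" for j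
  proof (rule nset_convergent_extend)
    show "u j \<subseteq> J"
      by (rule uJ)
    show eq: "fs f j i = A i" if "i \<in> u j" for i
      using that unfolding fs_def A_def by simp
    have "almost_disjoint_family {} S (u j) (fs f j)"
    proof
      show "{} \<notin> S" "{} \<notin> u j" "S \<inter> u j = {}"
        using z SJ uJ[of j] by auto
      show "fs f j i \<subseteq> S" if "i \<in> u j" for i
        using eq[OF that] A_subset[of i] uJ[of j] that by auto
      show "finite (fs f j i \<inter> fs f j k)" if "i \<in> u j" "k \<in> u j" "i \<noteq> k" for i k
        using eq A_Int[of i k] uJ[of j] that by auto
    qed
    then show "nset_convergent (almost_disjoint_family.franklin {} S (u j) (fs f j)) n (snd (f j)) (G j)"
      using f[of j] j unfolding P_def by blast
    show "G j ` nsets (snd (f j)) n \<subseteq> S"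
      using GS by auto
    fix k
    assume k: "k \<in> J - u j"
    \<comment> \<open>In both cases the range of \<open>G j\<close> was already fixed when
      \<open>A k\<close> was chosen.\<close>
    then have "j \<in> u k \<or> j = k"
      using total[of j k] j by auto
    then show "finite (A k \<inter> G j ` nsets (snd (f j)) n)"
      using AQ[of k j] k by blast
  qed
  moreover have "infinite (snd (f j))" if "j \<in> J" for j
    using f[of j] that unfolding P_def by blast
  ultimately have "\<exists>B. infinite B \<and> nset_convergent franklin n B (G j)" if "j \<in> J" for j
    using that by blast
  moreover have "almost_disjoint_family {} S J A"
    by unfold_locales
  ultimately show thesis
    using that[of A] seg unfolding J_def S_def by simp
qed

theorem theorem32:
  assumes "bounding_number =o |UNIV :: real set|"
  shows "\<forall>n\<ge>2. \<exists>X :: nat set topology.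
    Hausdorff_space X \<and> n_sequentially_compact n X \<and> \<not> n_sequentially_compact (n + 1) X"
proof (intro allI impI)
  fix n :: nat
  assume "n \<ge> 2"
  then have n: "n \<ge> 1"
    by simp
  obtain G :: "nat set \<Rightarrow> nat set \<Rightarrow> nat set" where G: "\<And>j s. G j s \<in> nsets UNIV (Suc n)"
    "\<And>g. g \<in> nsets UNIV n \<rightarrow> nsets UNIV (Suc n) \<Longrightarrow> \<exists>j. infinite j \<and> (\<forall>s\<in>nsets UNIV n. G j s = g s)"
    by (rule nset_function_codes[of "Suc n" n]) (rule that)
  obtain A :: "nat set \<Rightarrow> nat set set" where
    ad: "almost_disjoint_family {} (nsets UNIV (Suc n)) (Collect infinite) A" and
    seg: "\<And>j. infinite j \<Longrightarrow> \<exists>D\<subseteq>j. infinite D \<and> A j = segments n D" and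
    conv: "\<And>j. infinite j \<Longrightarrow> \<exists>B. infinite B \<and>
      nset_convergent (almost_disjoint_family.franklin {} (nsets UNIV (Suc n)) (Collect infinite) A) n B (G j)"
    by (rule diagonal_family[OF assms n G(1)]) (rule that)
  interpret almost_disjoint_family "{}" "nsets UNIV (Suc n)" "Collect infinite" A
    by (rule ad)
  have "n_sequentially_compact n franklin"
  proof (rule n_sequentially_compact_franklin)
    fix g :: "nat set \<Rightarrow> nat set"
    assume "g \<in> nsets (UNIV :: nat set) n \<rightarrow> nsets (UNIV :: nat set) (Suc n)"
    then obtain j where j: "infinite j" "\<forall>s\<in>nsets UNIV n. G j s = g s"
      using G(2) by blast
    obtain B p where B: "infinite B" "nset_converges_to franklin n B (G j) p"
      using conv[OF j(1)] unfolding nset_convergent_def by blast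
    have "nset_converges_to franklin n B g p"
      by (rule nset_converges_to_cong[OF B(2)]) (use j(2) nsets_mono[OF subset_UNIV] in blast)
    then show "\<exists>B. infinite B \<and> nset_convergent franklin n B g"
      using B(1) unfolding nset_convergent_def by blast
  next
    have "{..<Suc n} \<in> nsets UNIV (Suc n)"
      unfolding nsets_def by simp
    then show "nsets (UNIV :: nat set) (Suc n) \<noteq> {}"
      by blast
  qed
  moreover have "\<not> n_sequentially_compact (n + 1) franklin"
  proof
    assume "n_sequentially_compact (n + 1) franklin"
    moreover have "(\<lambda>t. t) \<in> nsets (UNIV :: nat set) (n + 1) \<rightarrow> topspace franklin"
      unfolding topspace_franklin by simp
    ultimately obtain B :: "nat set" and p where B: "infinite B" "nset_converges_to franklin (Suc n) B (\<lambda>t. t) p"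
      unfolding n_sequentially_compact_def nset_convergent_def by force
    have nbhd: "\<exists>B'\<subseteq>B. infinite B' \<and> finite (B - B') \<and> nsets B' (Suc n) \<subseteq> U" if U: "openin franklin U" "p \<in> U" for U
    proof -
      obtain F where F: "finite F" "F \<subseteq> B" "(\<lambda>t. t) ` nsets (B - F) (Suc n) \<subseteq> U"
        by (rule nset_converges_toE[OF B(2) U])
      moreover have "B - (B - F) = F"
        using F(2) by blast
      ultimately show ?thesis
        using B(1) by (intro exI[of _ "B - F"]) auto
    qed
    \<comment> \<open>This excludes a limit in \<open>J\<close>, since only finitely many blocks
      contain \<open>m\<close>.\<close>
    have many: "infinite {t \<in> nsets B' (Suc n). m \<in> t}" if B': "infinite B'" "m \<in> B'" for B' :: "nat set" and m
    proof
      assume fin: "finite {t \<in> nsets B' (Suc n). m \<in> t}"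
      have "insert m ` nsets (B' - {m}) n \<subseteq> {t \<in> nsets B' (Suc n). m \<in> t}"
        using B'(2) unfolding nsets_def by (auto simp: card_insert_if)
      then have "finite (insert m ` nsets (B' - {m}) n)"
        using fin by (rule finite_subset)
      moreover have "inj_on (insert m) (nsets (B' - {m}) n)"
        unfolding nsets_def by (rule inj_onI) blast
      ultimately have "finite (nsets (B' - {m}) n)"
        by (rule finite_imageD)
      moreover have "infinite (nsets (B' - {m}) n)"
        using B'(1) n by (intro infinite_imp_infinite_nsets) auto
      ultimately show False
        by simp
    qed
    have "p \<in> topspace franklin"
      by (rule nset_converges_to_topspace[OF B(2)])
    then consider "p \<in> nsets UNIV (Suc n)" | "infinite p" | "p = {}"
      unfolding topspace_franklin by blast
    then show False
    proof cases
      case 1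
      then obtain B' where B': "infinite B'" "nsets B' (Suc n) \<subseteq> {p}"
        using nbhd[OF openin_singleton] by blast
      have "infinite (nsets B' (Suc n))"
        using B'(1) by (intro infinite_imp_infinite_nsets) auto
      then show False
        using finite_subset[OF B'(2)] by simp
    next
      case 2
      obtain D where D: "infinite D" "A p = segments n D"
        using seg[OF 2] by blast
      obtain B' where B': "infinite B'" "nsets B' (Suc n) \<subseteq> insert p (A p)"
        using nbhd[OF openin_limit[of p "{}"]] 2 by auto
      obtain m where m: "m \<in> B'"
        using B'(1) infinite_imp_nonempty by blast
      have "t \<noteq> p" if "t \<in> nsets B' (Suc n)" for t
        using that 2 unfolding nsets_def by auto
      then have "{t \<in> nsets B' (Suc n). m \<in> t} \<subseteq> {t \<in> segments n D. m \<in> t}"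
        using B'(2) D(2) by blast
      then have "finite {t \<in> nsets B' (Suc n). m \<in> t}"
        by (rule finite_subset) (rule finite_segments_containing[OF D(1)])
      then show False
        using many[OF B'(1) m] by simp
    next
      case 3
      obtain D where D: "D \<subseteq> B" "infinite D" "A B = segments n D"
        using seg[OF B(1)] by blast
      \<comment> \<open>This neighbourhood of infinity omits all blocks of
        \<open>D \<subseteq> B\<close>, and every tail of \<open>B\<close> contains such
        blocks.\<close>
      have "openin franklin (topspace franklin - insert B (A B))"
        using B(1) by (intro openin_Diff_limit) simp
      moreover have "p \<in> topspace franklin - insert B (A B)"
        using z A_subset[of B] B(1) unfolding 3 topspace_franklin by auto
      ultimately obtain B' where B': "finite (B - B')" "nsets B' (Suc n) \<subseteq> topspace franklin - insert B (A B)"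
        using nbhd by blast
      obtain k where k: "B - B' \<subseteq> {..<k}"
        using B'(1) finite_nat_iff_bounded by blast
      have "D \<inter> {k..} \<subseteq> B'"
        using D(1) k by auto
      then have "init (Suc n) (D \<inter> {k..}) \<in> nsets B' (Suc n)"
        using segment_nsets[OF D(2), of n k] nsets_mono by blast
      moreover have "init (Suc n) (D \<inter> {k..}) \<in> A B"
        unfolding D(3) segments_def by blast
      ultimately show False
        using B'(2) by blast
    qed
  qed
  ultimately show "\<exists>X :: nat set topology.
    Hausdorff_space X \<and> n_sequentially_compact n X \<and> \<not> n_sequentially_compact (n + 1) X"
    using Hausdorff_franklin by blast
qed

end
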